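(* For a degenerate (i.e. vertically degenerate or horizontally degenerate) uniform grid model, there are constants $0<c\le C$ depending only on the model such that \[ c\,\frac{\log n}{n}\le\mathbb{E}[\operatorname{Fav}(S_n)]\le C\,\frac{\log n}{n}\qquad\text{for all } n\ge2. \]
   Context: Fix an integer $L\ge2$ and let $\mathcal{D}_n$ be the set of closed squares obtained by dividing $[0,1]^2$ into an $L^n\times L^n$ grid. A grid model is a probability distribution $\mathfrak X$ on finite sets of distinct squares of $\mathcal{D}_1$ (random number $\mathbf L$ of squares, bounded) with $\mathbb{E}[\mathbf L]=L$. Random sets: $\mathcal{S}_0=\{[0,1]^2\}$; given $\mathcal{S}_n$, for each $R\in\mathcal{S}_n$ independently (and independently of $\mathcal{S}_n$) sample from $\mathfrak X$ and map the chosen squares into $R$ via the natural homothety $[0,1]^2\to R$; $\mathcal{S}_{n+1}$ is the collection of resulting squares and $S_n=\bigcup\mathcal{S}_n$. Uniform: $\mathbb{P}[Q\in\mathcal{S}_1]=1/L$ for each $Q\in\mathcal{D}_1$. Vertically degenerate: almost surely $\mathcal{S}_1$ contains exactly one square in each column of the $L\times L$ grid; horizontally degenerate: almost surely exactly one square in each row. $\operatorname{Fav}(A)=\int_0^\pi|\operatorname{proj}_\theta A|\,d\theta$ where $\operatorname{proj}_\theta(x)=\langle x,(-\sin\theta,\cos\theta)\rangle$ and $|\cdot|$ is one-dimensional Lebesgue measure. *)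

theory Defs
  imports "HOL-Analysis.Analysis" "HOL-Probability.Probability"
begin

text \<open>Squares of the level-n grid D_n are indexed by pairs (a,b) of naturals with
  a,b < L^n; (a,b) is the closed square [a/L^n,(a+1)/L^n] x [b/L^n,(b+1)/L^n].
  The first index a is the column (x-coordinate), b the row (y-coordinate).
  A grid model is a pmf X on sets of squares of D_1, i.e. subsets of {..<L} x {..<L}.\<close>

definition grid_model :: "nat \<Rightarrow> (nat \<times> nat) set pmf \<Rightarrow> bool" where
  "grid_model L X \<longleftrightarrow>
     (\<forall>A\<in>set_pmf X. A \<subseteq> {..<L} \<times> {..<L}) \<and>
     measure_pmf.expectation X (\<lambda>A. real (card A)) = real L"

definition uniform_model :: "nat \<Rightarrow> (nat \<times> nat) set pmf \<Rightarrow> bool" where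
  "uniform_model L X \<longleftrightarrow>
     (\<forall>Q\<in>{..<L} \<times> {..<L}. measure_pmf.prob X {A. Q \<in> A} = 1 / real L)"

definition vert_degenerate :: "nat \<Rightarrow> (nat \<times> nat) set pmf \<Rightarrow> bool" where
  "vert_degenerate L X \<longleftrightarrow>
     (\<forall>A\<in>set_pmf X. \<forall>i<L. card {j. (i, j) \<in> A} = 1)"

definition horiz_degenerate :: "nat \<Rightarrow> (nat \<times> nat) set pmf \<Rightarrow> bool" where
  "horiz_degenerate L X \<longleftrightarrow>
     (\<forall>A\<in>set_pmf X. \<forall>j<L. card {i. (i, j) \<in> A} = 1)"

text \<open>One refinement step: each square R of the current collection independently
  receives a sample of X, mapped into R by the natural homothety.\<close>

definition refine :: "nat \<Rightarrow> (nat \<times> nat) set pmf \<Rightarrow> (nat \<times> nat) set \<Rightarrow> (nat \<times> nat) set pmf" where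
  "refine L X S =
     map_pmf (\<lambda>f. \<Union>R\<in>S. (\<lambda>(i, j). (L * fst R + i, L * snd R + j)) ` f R)
             (Pi_pmf S {} (\<lambda>_. X))"

primrec gen_sets :: "nat \<Rightarrow> (nat \<times> nat) set pmf \<Rightarrow> nat \<Rightarrow> (nat \<times> nat) set pmf" where
  "gen_sets L X 0 = return_pmf {(0, 0)}"
| "gen_sets L X (Suc n) = bind_pmf (gen_sets L X n) (refine L X)"

definition grid_square :: "nat \<Rightarrow> nat \<Rightarrow> nat \<times> nat \<Rightarrow> (real \<times> real) set" where
  "grid_square L n Q =
     cbox (real (fst Q) / real L ^ n, real (snd Q) / real L ^ n)
          ((real (fst Q) + 1) / real L ^ n, (real (snd Q) + 1) / real L ^ n)"

definition union_squares :: "nat \<Rightarrow> nat \<Rightarrow> (nat \<times> nat) set \<Rightarrow> (real \<times> real) set" where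
  "union_squares L n S = (\<Union>Q\<in>S. grid_square L n Q)"

definition proj :: "real \<Rightarrow> real \<times> real \<Rightarrow> real" where
  "proj \<theta> x = - fst x * sin \<theta> + snd x * cos \<theta>"

definition Fav :: "(real \<times> real) set \<Rightarrow> real" where
  "Fav A = (LBINT \<theta>:{0..pi}. measure lborel (proj \<theta> ` A))"

end

theory Submission
  imports Defs
begin

text \<open>For a line \<open>\<alpha> x + \<beta> y = s\<close> the probability of meeting \<open>S\<^sub>n\<close> obeys a deterministic recursion in
  \<open>(n, s)\<close>. After a flip and a swap of the coordinates the line is \<open>x + \<sigma> y = t\<close> with \<open>0 < \<sigma> \<le> 1\<close>, and the
  expected length of the projection is \<open>\<integral> p\<^sub>n\<close>, where \<open>p\<^sub>n t\<close> is the hitting probability.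

  Upper bound \<open>\<integral> p\<^sub>n \<le> C / (1 + \<sigma> n)\<close>, for every uniform model: explore the squares along the line depth
  first and stop at the first square of \<open>S\<^sub>n\<close>. The expected total length of the line in \<open>S\<^sub>n\<close> (rescaled by
  \<open>L\<^sup>n\<close>) is bounded, whereas every ancestor of the first square at which the line is in a good position
  contributes a definite amount through an unexplored sibling. Good positions have frequency of order
  \<open>\<sigma>\<close>, and paths with too few of them carry an exponentially small mass.

  Lower bound \<open>\<integral> p\<^sub>n \<ge> c / (1 + \<sigma> n)\<close> when every column holds exactly one square: by truncated
  inclusion-exclusion, since two squares in different columns have shadows overlapping in length
  \<open>O(\<sigma>)\<close> relative to their size.

  Integrating \<open>1 / (1 + \<sigma> n)\<close> over the directions, with \<open>\<sigma>\<close> comparable to the distance of the direction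
  from the degenerate axis, gives \<open>log n / n\<close>.\<close>

section \<open>Hitting probabilities of lines\<close>

text \<open>The obstacle is uniformity in \<sigma>. Seen from the child \<open>c\<close>, the good
  window has length \<sigma>/4, and it must be shown to receive a share of order \<sigma> of the
  mass. A delay of N levels with \<sigma> N bounded is harmless, because 1 / (1 + \<sigma> n) is
  bounded below for n up to 1/\<sigma>. A loss of exp (-1) per level is affordable on a bounded
  number of levels only; over log (1/\<sigma>) levels it would cost a power of \<sigma>. The long
  passage to scale \<sigma> therefore runs through the last column, which is never thinned because
  \<open>c\<close> is chosen outside it. The exploration is not built as a random process. It is
  encoded in one inequality, k p \<le> K g + exp k * \<open>thinned\<close>, proved for all real k
  at once, with k read as a budget; the final choice of k is a multiple of \<sigma> n. The lower
  bound has a similar free parameter a, of order 1 / (1 + \<sigma> n), which keeps the second-order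
  term below the first.\<close>

definition cells :: "nat \<Rightarrow> (nat \<times> nat) set" where
  "cells L = {..<L} \<times> {..<L}"

lemma finite_cells [simp]: "finite (cells L)"
  by (simp add: cells_def)

lemma card_cells: "card (cells L) = L * L"
  by (simp add: cells_def)

definition lin :: "real \<Rightarrow> real \<Rightarrow> nat \<times> nat \<Rightarrow> real" where
  "lin \<alpha> \<beta> d = \<alpha> * real (fst d) + \<beta> * real (snd d)"

definition shadow :: "real \<Rightarrow> real \<Rightarrow> real set" where
  "shadow \<alpha> \<beta> = {min 0 \<alpha> + min 0 \<beta> .. max 0 \<alpha> + max 0 \<beta>}"

text \<open>\<open>hit_prob L X \<alpha> \<beta> n s\<close> is the probability that the line \<open>\<alpha> x + \<beta> y = s\<close> meets \<open>S\<^sub>n\<close>;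
  the recursion splits off the first refinement, whereas \<^const>\<open>gen_sets\<close> splits off the last.\<close>

primrec hit_prob ::
    "nat \<Rightarrow> (nat \<times> nat) set pmf \<Rightarrow> real \<Rightarrow> real \<Rightarrow> nat \<Rightarrow> real \<Rightarrow> real" where
  "hit_prob L X \<alpha> \<beta> 0 s = indicator (shadow \<alpha> \<beta>) s"
| "hit_prob L X \<alpha> \<beta> (Suc n) s = measure_pmf.expectation X
     (\<lambda>A. 1 - (\<Prod>d\<in>A. 1 - hit_prob L X \<alpha> \<beta> n (real L * s - lin \<alpha> \<beta> d)))"

locale grid =
  fixes L :: nat and X :: "(nat \<times> nat) set pmf"
  assumes L_ge_2: "L \<ge> 2"
    and subset_cells: "A \<in> set_pmf X \<Longrightarrow> A \<subseteq> cells L"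
begin

lemma L_pos: "L > 0" and L_real: "real L \<ge> 2"
  using L_ge_2 by auto

lemma finite_sample: "A \<in> set_pmf X \<Longrightarrow> finite A"
  using subset_cells finite_subset finite_cells by metis

lemma finite_support [simp]: "finite (set_pmf X)"
  by (rule finite_subset[of _ "Pow (cells L)"]) (use subset_cells in auto)

lemma integrable_X [simp]: "integrable (measure_pmf X) (f :: _ \<Rightarrow> real)"
  by (rule integrable_measure_pmf_finite) simp

lemma expectation_mono:
  fixes f g :: "(nat \<times> nat) set \<Rightarrow> real"
  assumes "\<And>A. A \<in> set_pmf X \<Longrightarrow> f A \<le> g A"
  shows "measure_pmf.expectation X f \<le> measure_pmf.expectation X g"
  by (rule integral_mono_AE) (auto simp: AE_measure_pmf_iff assms)

lemma expectation_cong: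
  fixes f g :: "(nat \<times> nat) set \<Rightarrow> real"
  assumes "\<And>A. A \<in> set_pmf X \<Longrightarrow> f A = g A"
  shows "measure_pmf.expectation X f = measure_pmf.expectation X g"
  by (intro antisym expectation_mono) (simp_all add: assms)

lemma expectation_sum_pmf:
  fixes f :: "(nat \<times> nat) set \<Rightarrow> real"
  shows "measure_pmf.expectation X f = (\<Sum>A\<in>set_pmf X. f A * pmf X A)"
  by (rule integral_measure_pmf_real) auto

lemma hit_prob_range: "hit_prob L X \<alpha> \<beta> n s \<in> {0..1}"
proof (induction n arbitrary: s)
  case 0
  then show ?case by (auto simp: indicator_def)
next
  case (Suc n)
  have *: "0 \<le> 1 - (\<Prod>d\<in>A. 1 - hit_prob L X \<alpha> \<beta> n (real L * s - lin \<alpha> \<beta> d))"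
    "1 - (\<Prod>d\<in>A. 1 - hit_prob L X \<alpha> \<beta> n (real L * s - lin \<alpha> \<beta> d)) \<le> 1" for A
    using Suc by (auto intro!: prod_le_1 prod_nonneg)
  have "measure_pmf.expectation X (\<lambda>A. 1 - (\<Prod>d\<in>A. 1 - hit_prob L X \<alpha> \<beta> n (real L * s - lin \<alpha> \<beta> d)))
     \<le> measure_pmf.expectation X (\<lambda>A. 1)"
    by (rule expectation_mono) (rule *)
  moreover have "measure_pmf.expectation X (\<lambda>A. 0)
     \<le> measure_pmf.expectation X (\<lambda>A. 1 - (\<Prod>d\<in>A. 1 - hit_prob L X \<alpha> \<beta> n (real L * s - lin \<alpha> \<beta> d)))"
    by (rule expectation_mono) (rule *)
  ultimately show ?case by simp
qed

lemma hit_prob_nonneg: "0 \<le> hit_prob L X \<alpha> \<beta> n s"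
  and hit_prob_le_1: "hit_prob L X \<alpha> \<beta> n s \<le> 1"
  using hit_prob_range[of \<alpha> \<beta> n s] by auto

section \<open>Splitting off the last refinement versus the first\<close>

lemma finite_refine:
  assumes "finite S"
  shows "finite (set_pmf (refine L X S))"
    and "T \<in> set_pmf (refine L X S) \<Longrightarrow> finite T"
proof -
  show "finite (set_pmf (refine L X S))"
    unfolding refine_def using assms by (simp add: set_Pi_pmf finite_PiE_dflt)
  show "finite T" if "T \<in> set_pmf (refine L X S)"
    using that assms by (auto simp: refine_def set_Pi_pmf PiE_dflt_def finite_sample)
qed

lemma finite_gen_sets:
  "finite (set_pmf (gen_sets L X n))" "S \<in> set_pmf (gen_sets L X n) \<Longrightarrow> finite S"
proof (induction n arbitrary: S)
  case 0
  {
    case 1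
    then show ?case by simp
  next
    case 2
    then show ?case by simp
  }
next
  case (Suc n)
  {
    case 1
    then show ?case using Suc by (auto simp: finite_refine)
  next
    case 2
    then show ?case using Suc finite_refine(2) by auto
  }
qed

text \<open>Children of different parents never coincide, by uniqueness of base-\<open>L\<close>
  digits, so the product over the new collection factors over the parents and independence
  applies.\<close>

lemma expectation_prod_refine:
  fixes \<phi> :: "nat \<times> nat \<Rightarrow> real"
  assumes "finite S" and \<phi>: "\<And>Q. 0 \<le> \<phi> Q"
  shows "measure_pmf.expectation (refine L X S) (\<lambda>T. \<Prod>Q\<in>T. \<phi> Q) =
    (\<Prod>R\<in>S. measure_pmf.expectation X (\<lambda>A. \<Prod>d\<in>A. \<phi> (L * fst R + fst d, L * snd R + snd d)))"
proof -
  let ?h = "\<lambda>R (i, j). (L * fst R + i, L * snd R + j)"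
  have dig: "L * a + i = L * a' + i' \<longleftrightarrow> a = a' \<and> i = i'" if "i < L" "i' < L" for a a' i i' :: nat
  proof
    assume "L * a + i = L * a' + i'"
    then have "(L * a + i) div L = (L * a' + i') div L" "(L * a + i) mod L = (L * a' + i') mod L"
      by simp_all
    then show "a = a' \<and> i = i'" using that by simp
  qed simp
  have inner: "(\<Prod>Q\<in>(\<Union>R\<in>S. ?h R ` f R). \<phi> Q) = (\<Prod>R\<in>S. \<Prod>d\<in>f R. \<phi> (L * fst R + fst d, L * snd R + snd d))"
    if "f \<in> set_pmf (Pi_pmf S {} (\<lambda>_. X))" for f
  proof -
    have f: "f R \<subseteq> cells L" if "R \<in> S" for R
    proof (rule subset_cells)
      show "f R \<in> set_pmf X"
        using that \<open>f \<in> _\<close> \<open>finite S\<close> by (cases R) (auto simp: set_Pi_pmf PiE_dflt_def)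
    qed
    have "(\<Prod>Q\<in>(\<Union>R\<in>S. ?h R ` f R). \<phi> Q) = (\<Prod>R\<in>S. \<Prod>Q\<in>?h R ` f R. \<phi> Q)"
    proof (rule prod.UNION_disjoint)
      show "\<forall>R\<in>S. finite (?h R ` f R)"
        using f finite_subset[OF _ finite_cells] by blast
      show "\<forall>R\<in>S. \<forall>R'\<in>S. R \<noteq> R' \<longrightarrow> ?h R ` f R \<inter> ?h R' ` f R' = {}"
      proof (intro ballI impI equals0I)
        fix R R' Q assume "R \<in> S" "R' \<in> S" "R \<noteq> R'" "Q \<in> ?h R ` f R \<inter> ?h R' ` f R'"
        then obtain i j i' j' where "(i, j) \<in> f R" "(i', j') \<in> f R'"
          "Q = ?h R (i, j)" "Q = ?h R' (i', j')" by auto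
        with f[OF \<open>R \<in> S\<close>] f[OF \<open>R' \<in> S\<close>] have "R = R'"
          by (auto simp: dig cells_def subset_iff prod_eq_iff)
        with \<open>R \<noteq> R'\<close> show False by simp
      qed
    qed (use \<open>finite S\<close> in auto)
    also have "\<dots> = (\<Prod>R\<in>S. \<Prod>d\<in>f R. \<phi> (L * fst R + fst d, L * snd R + snd d))"
    proof (rule prod.cong[OF refl])
      fix R assume "R \<in> S"
      have "inj_on (?h R) (f R)"
        using f[OF \<open>R \<in> S\<close>] by (auto simp: inj_on_def cells_def dig)
      then show "(\<Prod>Q\<in>?h R ` f R. \<phi> Q) = (\<Prod>d\<in>f R. \<phi> (L * fst R + fst d, L * snd R + snd d))"
        by (simp add: prod.reindex case_prod_unfold)
    qed
    finally show ?thesis .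
  qed
  have "measure_pmf.expectation (refine L X S) (\<lambda>T. \<Prod>Q\<in>T. \<phi> Q) =
     measure_pmf.expectation (Pi_pmf S {} (\<lambda>_. X))
       (\<lambda>f. \<Prod>R\<in>S. \<Prod>d\<in>f R. \<phi> (L * fst R + fst d, L * snd R + snd d))"
    unfolding refine_def integral_map_pmf
    by (intro integral_cong_AE) (auto simp: AE_measure_pmf_iff inner)
  also have "\<dots> = (\<Prod>R\<in>S. measure_pmf.expectation X
      (\<lambda>A. \<Prod>d\<in>A. \<phi> (L * fst R + fst d, L * snd R + snd d)))"
    by (rule expectation_prod_Pi_pmf) (use assms in \<open>auto intro!: prod_nonneg\<close>)
  finally show ?thesis .
qed

text \<open>The bridge between the two recursions: \<open>gen_sets\<close> generates
  \<open>n\<close> levels, \<open>hit_prob\<close> integrates out \<open>k\<close> further ones.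
  Each induction step moves the last generated level to the other side; for \<open>k = 0\<close> the
  product is the indicator that the line misses every square.\<close>

lemma expectation_prod_gen_sets:
  "measure_pmf.expectation (gen_sets L X n)
     (\<lambda>T. \<Prod>Q\<in>T. 1 - hit_prob L X \<alpha> \<beta> k (real L ^ n * s - lin \<alpha> \<beta> Q)) = 1 - hit_prob L X \<alpha> \<beta> (n + k) s"
proof (induction n arbitrary: k)
  case 0
  then show ?case by (simp add: lin_def)
next
  case (Suc n)
  let ?\<phi> = "\<lambda>Q. 1 - hit_prob L X \<alpha> \<beta> k (real L ^ Suc n * s - lin \<alpha> \<beta> Q)"
  have step: "measure_pmf.expectation (refine L X S) (\<lambda>T. \<Prod>Q\<in>T. ?\<phi> Q) =
      (\<Prod>R\<in>S. 1 - hit_prob L X \<alpha> \<beta> (Suc k) (real L ^ n * s - lin \<alpha> \<beta> R))"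
    if "S \<in> set_pmf (gen_sets L X n)" for S
  proof -
    have "measure_pmf.expectation (refine L X S) (\<lambda>T. \<Prod>Q\<in>T. ?\<phi> Q) =
      (\<Prod>R\<in>S. measure_pmf.expectation X (\<lambda>A. \<Prod>d\<in>A. ?\<phi> (L * fst R + fst d, L * snd R + snd d)))"
      by (rule expectation_prod_refine) (use finite_gen_sets that hit_prob_le_1 in auto)
    also have "\<dots> = (\<Prod>R\<in>S. 1 - hit_prob L X \<alpha> \<beta> (Suc k) (real L ^ n * s - lin \<alpha> \<beta> R))"
    proof (rule prod.cong[OF refl])
      fix R assume "R \<in> S"
      have "real L ^ Suc n * s - lin \<alpha> \<beta> (L * fst R + fst d, L * snd R + snd d) =
        real L * (real L ^ n * s - lin \<alpha> \<beta> R) - lin \<alpha> \<beta> d" for d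
        by (simp add: lin_def algebra_simps)
      then show "measure_pmf.expectation X (\<lambda>A. \<Prod>d\<in>A. ?\<phi> (L * fst R + fst d, L * snd R + snd d)) =
        1 - hit_prob L X \<alpha> \<beta> (Suc k) (real L ^ n * s - lin \<alpha> \<beta> R)"
        by simp
    qed
    finally show ?thesis .
  qed
  have "measure_pmf.expectation (gen_sets L X (Suc n)) (\<lambda>T. \<Prod>Q\<in>T. ?\<phi> Q) =
     (\<Sum>S\<in>set_pmf (gen_sets L X n). pmf (gen_sets L X n) S *\<^sub>R
        measure_pmf.expectation (refine L X S) (\<lambda>T. \<Prod>Q\<in>T. ?\<phi> Q))"
    unfolding gen_sets.simps
    by (rule pmf_expectation_bind) (auto simp: finite_gen_sets finite_refine)
  also have "\<dots> = (\<Sum>S\<in>set_pmf (gen_sets L X n). pmf (gen_sets L X n) S *\<^sub>R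
        (\<Prod>R\<in>S. 1 - hit_prob L X \<alpha> \<beta> (Suc k) (real L ^ n * s - lin \<alpha> \<beta> R)))"
    by (rule sum.cong) (simp_all only: step)
  also have "\<dots> = measure_pmf.expectation (gen_sets L X n)
        (\<lambda>S. \<Prod>R\<in>S. 1 - hit_prob L X \<alpha> \<beta> (Suc k) (real L ^ n * s - lin \<alpha> \<beta> R))"
    by (rule integral_measure_pmf[symmetric]) (auto simp: finite_gen_sets)
  also have "\<dots> = 1 - hit_prob L X \<alpha> \<beta> (n + Suc k) s"
    by (rule Suc.IH)
  finally show ?case by simp
qed

lemma hit_prob_measurable [measurable]: "hit_prob L X \<alpha> \<beta> n \<in> borel_measurable borel"
proof (induction n)
  case 0
  then show ?case by (simp add: shadow_def)
next
  case (Suc n)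
  note [measurable] = Suc
  show ?case by (simp add: expectation_sum_pmf)
qed

end

section \<open>Expected Favard length as an integral of hitting probabilities\<close>

lemma proj_grid_square:
  fixes L :: nat
  assumes "L > 0"
  shows "proj \<theta> ` grid_square L n Q =
    {t. real L ^ n * t - lin (- sin \<theta>) (cos \<theta>) Q \<in> shadow (- sin \<theta>) (cos \<theta>)}"
proof -
  define N where "N = real L ^ n"
  have N: "N > 0" using assms by (simp add: N_def)
  obtain a b where Q: "Q = (a, b)" by (cases Q)
  define \<alpha> \<beta> where "\<alpha> = - sin \<theta>" and "\<beta> = cos \<theta>"
  have mem: "(x, y) \<in> grid_square L n Q \<longleftrightarrow> N * x - a \<in> {0..1} \<and> N * y - b \<in> {0..1}" for x y
    using N unfolding grid_square_def Q N_def[symmetric]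
    by (auto simp: cbox_Pair_eq field_simps)
  have lo: "min 0 \<alpha> \<le> \<alpha> * u" "\<alpha> * u \<le> max 0 \<alpha>" if "u \<in> {0..1}" for u \<alpha> :: real
  proof -
    have "\<alpha> * u \<le> \<alpha>" if "\<alpha> \<ge> 0" using that \<open>u \<in> _\<close> by (simp add: mult_left_le)
    moreover have "\<alpha> * u \<ge> \<alpha>" if "\<alpha> \<le> 0" using that \<open>u \<in> _\<close>
      by (simp add: mult_le_cancel_left1 not_less)
    ultimately show "min 0 \<alpha> \<le> \<alpha> * u" "\<alpha> * u \<le> max 0 \<alpha>"
      using that by (cases "\<alpha> \<ge> 0"; simp add: mult_nonneg_nonneg mult_nonpos_nonneg)+
  qed
  have surj: "\<exists>u\<in>{0..1}. \<exists>v\<in>{0..1}. s = \<alpha> * u + \<beta> * v" if "s \<in> shadow \<alpha> \<beta>" for s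
  proof -
    \<comment> \<open>The diagonal of the unit square from a corner minimising
      \<open>\<alpha> u + \<beta> v\<close> to one maximising it; the intermediate value theorem
      gives a point above every \<open>s\<close>.\<close>
    define f where "f w = \<alpha> * ((1 - w) * (if \<alpha> \<ge> 0 then 0 else 1) + w * (if \<alpha> \<ge> 0 then 1 else 0))
       + \<beta> * ((1 - w) * (if \<beta> \<ge> 0 then 0 else 1) + w * (if \<beta> \<ge> 0 then 1 else 0))" for w :: real
    have "\<exists>w\<ge>0. w \<le> 1 \<and> f w = s"
      by (rule IVT'[of f]) (use that in \<open>auto simp: f_def shadow_def min_def max_def intro!: continuous_intros split: if_splits\<close>)
    then obtain w where w: "0 \<le> w" "w \<le> 1" "f w = s" by blast
    show ?thesis
      by (rule bexI[of _ "(1 - w) * (if \<alpha> \<ge> 0 then 0 else 1) + w * (if \<alpha> \<ge> 0 then 1 else 0)"],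
          rule bexI[of _ "(1 - w) * (if \<beta> \<ge> 0 then 0 else 1) + w * (if \<beta> \<ge> 0 then 1 else 0)"])
        (use w in \<open>auto simp: f_def\<close>)
  qed
  have "t \<in> proj \<theta> ` grid_square L n Q \<longleftrightarrow> N * t - lin \<alpha> \<beta> Q \<in> shadow \<alpha> \<beta>" for t
  proof
    assume "t \<in> proj \<theta> ` grid_square L n Q"
    then obtain x y where xy: "(x, y) \<in> grid_square L n Q" "t = \<alpha> * x + \<beta> * y"
      by (auto simp: proj_def \<alpha>_def \<beta>_def)
    then have "N * t - lin \<alpha> \<beta> Q = \<alpha> * (N * x - a) + \<beta> * (N * y - b)"
      by (simp add: lin_def Q algebra_simps)
    then show "N * t - lin \<alpha> \<beta> Q \<in> shadow \<alpha> \<beta>"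
      using xy(1) lo[of "N * x - a" \<alpha>] lo[of "N * y - b" \<beta>] unfolding mem
      by (simp add: shadow_def)
  next
    assume "N * t - lin \<alpha> \<beta> Q \<in> shadow \<alpha> \<beta>"
    then obtain u v where uv: "u \<in> {0..1}" "v \<in> {0..1}" "N * t - lin \<alpha> \<beta> Q = \<alpha> * u + \<beta> * v"
      using surj by blast
    have "((u + a) / N, (v + b) / N) \<in> grid_square L n Q"
      unfolding mem using uv N by simp
    moreover have "proj \<theta> ((u + a) / N, (v + b) / N) = t"
    proof -
      have "proj \<theta> ((u + a) / N, (v + b) / N) = (\<alpha> * u + \<beta> * v + lin \<alpha> \<beta> Q) / N"
        by (simp add: proj_def lin_def Q \<alpha>_def \<beta>_def algebra_simps add_divide_distrib diff_divide_distrib)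
      also have "\<dots> = t"
        unfolding uv(3)[symmetric] using N by simp
      finally show ?thesis .
    qed
    ultimately show "t \<in> proj \<theta> ` grid_square L n Q"
      by (metis image_eqI)
  qed
  then show ?thesis
    by (auto simp: N_def \<alpha>_def \<beta>_def)
qed

context grid
begin

text \<open>Fubini with finitely many outcomes: exchanging expectation and integrals replaces the
  random set by the hitting probability of each line. Joint measurability holds because a projection
  is a finite union of intervals whose endpoints are measurable in the direction.\<close>

lemma expected_Fav:
  defines "I \<equiv> \<lambda>n \<theta>. LBINT s. hit_prob L X (- sin \<theta>) (cos \<theta>) n s"
  shows "set_integrable lborel {0..pi} (I n)"
    and "measure_pmf.expectation (gen_sets L X n) (\<lambda>S. Fav (union_squares L n S)) =
      (LBINT \<theta>:{0..pi}. I n \<theta>)"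
proof -
  let ?G = "gen_sets L X n"
  define V where "V S \<theta> = proj \<theta> ` union_squares L n S" for S \<theta>
  define lo where "lo \<theta> = min 0 (- sin \<theta>) + min 0 (cos \<theta>)" for \<theta> :: real
  define hi where "hi \<theta> = max 0 (- sin \<theta>) + max 0 (cos \<theta>)" for \<theta> :: real
  have [measurable]: "sin \<in> borel_measurable (borel :: real measure)"
    "cos \<in> borel_measurable (borel :: real measure)"
    by (auto intro!: borel_measurable_continuous_onI continuous_intros)
  have [measurable]: "lo \<in> borel_measurable borel" "hi \<in> borel_measurable borel"
    unfolding lo_def hi_def by measurable
  have V: "t \<in> V S \<theta> \<longleftrightarrow> (\<exists>Q\<in>S. lo \<theta> \<le> real L ^ n * t - lin (- sin \<theta>) (cos \<theta>) Q \<and>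
       real L ^ n * t - lin (- sin \<theta>) (cos \<theta>) Q \<le> hi \<theta>)" for t S \<theta>
  proof -
    have "V S \<theta> = (\<Union>Q\<in>S. proj \<theta> ` grid_square L n Q)"
      by (auto simp: V_def union_squares_def)
    then show ?thesis
      by (simp add: proj_grid_square[OF L_pos] shadow_def lo_def hi_def)
  qed
  have V_meas [measurable]: "(\<lambda>(\<theta>, t). indicator (V S \<theta>) t :: real) \<in> borel_measurable (borel \<Otimes>\<^sub>M borel)"
    if "finite S" for S
    unfolding indicator_def V lin_def using that by measurable
  have V_sets [measurable]: "V S \<theta> \<in> sets borel" if "finite S" for S \<theta>
  proof -
    have "V S \<theta> = {t \<in> space borel. \<exists>Q\<in>S. lo \<theta> \<le> real L ^ n * t - lin (- sin \<theta>) (cos \<theta>) Q \<and>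
       real L ^ n * t - lin (- sin \<theta>) (cos \<theta>) Q \<le> hi \<theta>}"
      using V by auto
    also have "\<dots> \<in> sets borel" using that by measurable
    finally show ?thesis .
  qed
  have V_bound: "emeasure lborel (V S \<theta>) \<le> ennreal (4 * real (card S))"
    if "finite S" for S \<theta>
  proof -
    have "V S \<theta> \<subseteq> (\<Union>Q\<in>S. {(lin (- sin \<theta>) (cos \<theta>) Q + lo \<theta>) / real L ^ n ..
        (lin (- sin \<theta>) (cos \<theta>) Q + hi \<theta>) / real L ^ n})" (is "_ \<subseteq> (\<Union>Q\<in>S. ?J Q)")
      using L_pos by (auto simp: V field_simps)
    then have "emeasure lborel (V S \<theta>) \<le> emeasure lborel (\<Union>Q\<in>S. ?J Q)"
      by (rule emeasure_mono) (use that in auto)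
    also have "\<dots> \<le> (\<Sum>Q\<in>S. emeasure lborel (?J Q))"
      by (rule emeasure_subadditive_finite) (use that in auto)
    also have "\<dots> \<le> (\<Sum>Q\<in>S. ennreal 4)"
    proof (rule sum_mono)
      fix Q
      have le: "(c + lo \<theta>) / real L ^ n \<le> (c + hi \<theta>) / real L ^ n" for c
        by (rule divide_right_mono) (auto simp: lo_def hi_def)
      have "hi \<theta> - lo \<theta> = \<bar>sin \<theta>\<bar> + \<bar>cos \<theta>\<bar>"
        by (simp add: lo_def hi_def max_def min_def)
      then have "hi \<theta> - lo \<theta> \<le> 4"
        using abs_sin_le_one[of \<theta>] abs_cos_le_one[of \<theta>] by linarith
      moreover have "real L ^ n \<ge> 1" using L_pos by simp
      ultimately have "hi \<theta> - lo \<theta> \<le> 4 * real L ^ n" by linarith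
      then have "(hi \<theta> - lo \<theta>) / real L ^ n \<le> 4"
        using L_pos by (subst pos_divide_le_eq) auto
      then have "ennreal ((hi \<theta> - lo \<theta>) / real L ^ n) \<le> ennreal 4"
        by (rule ennreal_leI)
      moreover have "emeasure lborel (?J Q) = ennreal ((hi \<theta> - lo \<theta>) / real L ^ n)"
        using le by (simp add: diff_divide_distrib add_divide_distrib)
      ultimately show "emeasure lborel (?J Q) \<le> ennreal 4" by simp
    qed
    also have "\<dots> = ennreal (4 * real (card S))"
      by (simp add: ennreal_mult' ennreal_of_nat_eq_real_of_nat mult.commute)
    finally show ?thesis .
  qed
  have V_fin: "emeasure lborel (V S \<theta>) < \<infinity>" if "finite S" for S \<theta>
    using V_bound[OF that] by (rule le_less_trans) simp
  have V_int: "integrable lborel (indicator (V S \<theta>) :: _ \<Rightarrow> real)" if "finite S" for S \<theta>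
    using that V_fin by (intro integrable_real_indicator) auto
  have V_eq: "measure lborel (V S \<theta>) = (LBINT t. indicator (V S \<theta>) t)" if "finite S" for S \<theta>
    using that by simp
  have F_int: "set_integrable lborel {0..pi} (\<lambda>\<theta>. measure lborel (V S \<theta>))" if "finite S" for S
    unfolding set_integrable_def
  proof (rule integrableI_bounded_set[where A = "{0..pi}" and B = "4 * real (card S)"])
    have "(\<lambda>\<theta>. LBINT t. indicator (V S \<theta>) t :: real) \<in> borel_measurable lborel"
      using V_meas[OF that] by (intro lborel.borel_measurable_lebesgue_integral) simp
    then show "(\<lambda>\<theta>. indicator {0..pi} \<theta> *\<^sub>R measure lborel (V S \<theta>)) \<in> borel_measurable lborel"
      unfolding V_eq[OF that, symmetric] by measurable
    show "AE \<theta>\<in>{0..pi} in lborel. norm (indicator {0..pi} \<theta> *\<^sub>R measure lborel (V S \<theta>)) \<le> 4 * real (card S)"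
      using V_bound[OF that] by (auto simp: measure_def intro!: enn2real_leI)
  qed (auto simp: emeasure_lborel_Icc_eq)
  have I: "I n \<theta> = (\<Sum>S\<in>set_pmf ?G. pmf ?G S * measure lborel (V S \<theta>))" for \<theta>
  proof -
    have pt: "hit_prob L X (- sin \<theta>) (cos \<theta>) n s = (\<Sum>S\<in>set_pmf ?G. pmf ?G S * indicator (V S \<theta>) s)" for s
    proof -
      have ind: "(\<Prod>Q\<in>S. 1 - hit_prob L X (- sin \<theta>) (cos \<theta>) 0 (real L ^ n * s - lin (- sin \<theta>) (cos \<theta>) Q))
         = 1 - indicator (V S \<theta>) s" if "finite S" for S
        using that by (auto simp: indicator_def V shadow_def lo_def hi_def intro!: prod.neutral)
      have "1 - hit_prob L X (- sin \<theta>) (cos \<theta>) (n + 0) s = measure_pmf.expectation ?G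
         (\<lambda>S. \<Prod>Q\<in>S. 1 - hit_prob L X (- sin \<theta>) (cos \<theta>) 0 (real L ^ n * s - lin (- sin \<theta>) (cos \<theta>) Q))"
        by (rule expectation_prod_gen_sets[symmetric])
      also have "\<dots> = measure_pmf.expectation ?G (\<lambda>S. 1 - indicator (V S \<theta>) s)"
        by (intro integral_cong_AE) (auto simp: AE_measure_pmf_iff ind finite_gen_sets simp del: hit_prob.simps)
      also have "\<dots> = 1 - measure_pmf.expectation ?G (\<lambda>S. indicator (V S \<theta>) s)"
        by (subst Bochner_Integration.integral_diff)
          (auto intro!: integrable_measure_pmf_finite finite_gen_sets)
      also have "measure_pmf.expectation ?G (\<lambda>S. indicator (V S \<theta>) s) =
          (\<Sum>S\<in>set_pmf ?G. pmf ?G S *\<^sub>R (indicator (V S \<theta>) s :: real))"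
        by (rule integral_measure_pmf) (auto simp: finite_gen_sets)
      finally show ?thesis by simp
    qed
    show ?thesis
      unfolding I_def pt
      by (subst Bochner_Integration.integral_sum)
        (auto intro!: sum.cong integrable_mult_right V_int simp: finite_gen_sets)
  qed
  have F_int': "integrable lborel (\<lambda>\<theta>. indicator {0..pi} \<theta> *\<^sub>R (pmf ?G S * measure lborel (V S \<theta>)))"
    if "S \<in> set_pmf ?G" for S
  proof -
    have "integrable lborel (\<lambda>\<theta>. pmf ?G S * (indicator {0..pi} \<theta> *\<^sub>R measure lborel (V S \<theta>)))"
      using F_int[of S] finite_gen_sets(2)[OF that]
      by (intro integrable_mult_right) (auto simp: set_integrable_def)
    then show ?thesis by (simp add: mult_ac)
  qed
  show "set_integrable lborel {0..pi} (I n)"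
    unfolding I[abs_def] set_integrable_def scaleR_sum_right
    by (intro Bochner_Integration.integrable_sum F_int')
  have "measure_pmf.expectation ?G (\<lambda>S. Fav (union_squares L n S)) =
     (\<Sum>S\<in>set_pmf ?G. pmf ?G S *\<^sub>R Fav (union_squares L n S))"
    by (rule integral_measure_pmf) (auto simp: finite_gen_sets)
  also have "\<dots> = (\<Sum>S\<in>set_pmf ?G. LBINT \<theta>:{0..pi}. pmf ?G S * measure lborel (V S \<theta>))"
    by (simp add: Fav_def V_def)
  also have "\<dots> = (LBINT \<theta>:{0..pi}. I n \<theta>)"
    unfolding I set_lebesgue_integral_def scaleR_sum_right
    by (intro Bochner_Integration.integral_sum[symmetric] F_int')
  finally show "measure_pmf.expectation ?G (\<lambda>S. Fav (union_squares L n S)) =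
      (LBINT \<theta>:{0..pi}. I n \<theta>)" .
qed

text \<open>\<open>e\<close> relabels the children. The factor \<open>L - 1\<close> is forced: the
  recursion sends \<open>s\<close> to \<open>L s - lin d\<close>, so a translation by
  \<open>\<kappa>\<close> survives a step only if the offsets absorb the difference
  \<open>L \<kappa> - \<kappa>\<close>.\<close>

lemma hit_prob_transform:
  assumes e: "inj_on e (cells L)" and \<mu>: "\<mu> \<noteq> 0"
    and lin: "\<And>d. d \<in> cells L \<Longrightarrow> lin \<alpha> \<beta> d = \<mu> * lin \<alpha>' \<beta>' (e d) - (real L - 1) * \<kappa>"
    and shadow: "\<And>s. s \<in> shadow \<alpha> \<beta> \<longleftrightarrow> (s + \<kappa>) / \<mu> \<in> shadow \<alpha>' \<beta>'"
  shows "hit_prob L X \<alpha> \<beta> n s = hit_prob L (map_pmf (image e) X) \<alpha>' \<beta>' n ((s + \<kappa>) / \<mu>)"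
proof (induction n arbitrary: s)
  case 0
  then show ?case by (simp add: shadow indicator_def)
next
  case (Suc n)
  let ?p = "hit_prob L (map_pmf (image e) X) \<alpha>' \<beta>' n"
  have "(\<Prod>d\<in>A. 1 - hit_prob L X \<alpha> \<beta> n (real L * s - lin \<alpha> \<beta> d)) =
     (\<Prod>d\<in>e ` A. 1 - ?p (real L * ((s + \<kappa>) / \<mu>) - lin \<alpha>' \<beta>' d))" if "A \<in> set_pmf X" for A
  proof -
    have A: "A \<subseteq> cells L" using subset_cells[OF that] .
    have "(real L * s - lin \<alpha> \<beta> d + \<kappa>) / \<mu> = real L * ((s + \<kappa>) / \<mu>) - lin \<alpha>' \<beta>' (e d)"
      if "d \<in> A" for d
      using lin[of d] that A \<mu> by (auto simp: field_simps)
    then show ?thesis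
      using inj_on_subset[OF e A] by (simp add: prod.reindex Suc)
  qed
  then show ?case
    by (auto intro!: expectation_cong)
qed

lemma integral_hit_prob_transform:
  assumes "inj_on e (cells L)" "\<mu> \<noteq> 0"
    "\<And>d. d \<in> cells L \<Longrightarrow> lin \<alpha> \<beta> d = \<mu> * lin \<alpha>' \<beta>' (e d) - (real L - 1) * \<kappa>"
    "\<And>s. s \<in> shadow \<alpha> \<beta> \<longleftrightarrow> (s + \<kappa>) / \<mu> \<in> shadow \<alpha>' \<beta>'"
  shows "(LBINT s. hit_prob L X \<alpha> \<beta> n s) =
    \<bar>\<mu>\<bar> * (LBINT s. hit_prob L (map_pmf (image e) X) \<alpha>' \<beta>' n s)"
proof -
  have "hit_prob L X \<alpha> \<beta> n (- \<kappa> + \<mu> * x) = hit_prob L (map_pmf (image e) X) \<alpha>' \<beta>' n x" for x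
    using assms(2) by (simp add: hit_prob_transform[OF assms])
  then show ?thesis
    using lborel_integral_real_affine[OF assms(2), of "hit_prob L X \<alpha> \<beta> n" "- \<kappa>"] by simp
qed

end

locale uniform_grid = grid +
  assumes uniform: "Q \<in> cells L \<Longrightarrow> measure_pmf.prob X {A. Q \<in> A} = 1 / real L"
begin

lemma uniform_grid_map:
  assumes "bij_betw e (cells L) (cells L)"
  shows "uniform_grid L (map_pmf (image e) X)"
proof
  show "2 \<le> L" by (rule L_ge_2)
  show "A \<subseteq> cells L" if "A \<in> set_pmf (map_pmf (image e) X)" for A
    using that subset_cells assms by (fastforce simp: bij_betw_def)
  show "measure_pmf.prob (map_pmf (image e) X) {A. Q \<in> A} = 1 / real L" if Q: "Q \<in> cells L" for Q
  proof -
    obtain R where R: "R \<in> cells L" "Q = e R"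
      using Q assms unfolding bij_betw_def by (metis imageE)
    have "Q \<in> e ` A \<longleftrightarrow> R \<in> A" if "A \<in> set_pmf X" for A
      using subset_cells[OF that] R assms by (auto simp: bij_betw_def inj_on_def)
    then have "measure_pmf.prob X {A. Q \<in> e ` A} = measure_pmf.prob X {A. R \<in> A}"
      by (intro measure_pmf.finite_measure_eq_AE) (auto simp: AE_measure_pmf_iff)
    then show ?thesis using uniform[OF R(1)] by (simp add: vimage_def)
  qed
qed

lemma expectation_sum:
  fixes f :: "nat \<times> nat \<Rightarrow> real"
  shows "measure_pmf.expectation X (\<lambda>A. \<Sum>d\<in>A. f d) = (\<Sum>d\<in>cells L. f d) / real L"
proof -
  have "measure_pmf.expectation X (\<lambda>A. \<Sum>d\<in>A. f d) =
     measure_pmf.expectation X (\<lambda>A. \<Sum>d\<in>cells L. f d * indicator {A. d \<in> A} A)"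
  proof (rule expectation_cong)
    fix A assume "A \<in> set_pmf X"
    then have "A \<subseteq> cells L" by (rule subset_cells)
    then show "(\<Sum>d\<in>A. f d) = (\<Sum>d\<in>cells L. f d * indicator {A. d \<in> A} A)"
      by (intro sum.mono_neutral_cong_left) auto
  qed
  also have "\<dots> = (\<Sum>d\<in>cells L. f d * (1 / real L))"
    by (subst Bochner_Integration.integral_sum) (auto intro!: sum.cong simp: uniform)
  finally show ?thesis by (simp add: sum_divide_distrib)
qed

end

section \<open>Lower bound for steep lines\<close>

lemma integral_affine_shift:
  fixes f :: "real \<Rightarrow> real"
  assumes "L > 0"
  shows "(LBINT t. f (L * t - c)) = (LBINT t. f t) / L"
  using lborel_integral_real_affine[of L f "- c"] assms by (simp add: field_simps)

lemma integrable_affine_shift: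
  fixes f :: "real \<Rightarrow> real"
  assumes "L > 0" "integrable lborel f"
  shows "integrable lborel (\<lambda>t. f (L * t - c))"
  using lborel_integrable_real_affine[OF assms(2), of L "- c"] assms by simp

text \<open>The second Bonferroni inequality for independent events, weakened by counting every pair
  twice; each insertion uses the first-order bound on the product.\<close>

lemma sum_minus_pairs_le_1_minus_prod:
  fixes y :: "'a \<Rightarrow> real"
  assumes "finite A" "\<And>d. d \<in> A \<Longrightarrow> 0 \<le> y d \<and> y d \<le> 1"
  shows "(\<Sum>d\<in>A. y d) - (\<Sum>d\<in>A. \<Sum>d'\<in>A - {d}. y d * y d') \<le> 1 - (\<Prod>d\<in>A. 1 - y d)"
  using assms
proof (induction A rule: finite_induct)
  case (insert x A)
  let ?P = "\<Prod>d\<in>A. 1 - y d" and ?S = "\<Sum>d\<in>A. y d"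
  have y: "0 \<le> y d" "y d \<le> 1" if "d \<in> insert x A" for d
    using insert.prems that by auto
  have "1 - ?S \<le> ?P"
    using Weierstrass_prod_ineq[of A y] y by auto
  then have "y x * (1 - ?S) \<le> y x * ?P"
    using y by (intro mult_left_mono) auto
  moreover have "(\<Sum>d\<in>A. \<Sum>d'\<in>insert x A - {d}. y d * y d') \<ge> (\<Sum>d\<in>A. \<Sum>d'\<in>A - {d}. y d * y d')"
    using insert.hyps y by (intro sum_mono sum_mono2) auto
  moreover have "(\<Sum>d'\<in>insert x A - {x}. y x * y d') = y x * ?S"
    using insert.hyps by (simp add: sum_distrib_left)
  moreover have "?S - (\<Sum>d\<in>A. \<Sum>d'\<in>A - {d}. y d * y d') \<le> 1 - ?P"
    using insert y by auto
  ultimately show ?case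
    using insert.hyps by (simp add: algebra_simps)
qed simp

definition clamp01 :: "real \<Rightarrow> real" where
  "clamp01 x = max 0 (min 1 x)"

lemma sum_clamp01: "(\<Sum>j<n. clamp01 (x - real j)) = max 0 (min (real n) x)"
  by (induction n) (auto simp: clamp01_def max_def min_def)

text \<open>The height of the part of the line \<open>x + \<sigma> y = t\<close> inside the unit square.\<close>

definition chord :: "real \<Rightarrow> real \<Rightarrow> real" where
  "chord \<sigma> t = clamp01 (t / \<sigma>) - clamp01 ((t - 1) / \<sigma>)"

locale steep_lines = uniform_grid +
  fixes \<sigma> :: real
  assumes sigma_pos: "0 < \<sigma>" and sigma_le_1: "\<sigma> \<le> 1"
begin

abbreviation p :: "nat \<Rightarrow> real \<Rightarrow> real" where "p \<equiv> hit_prob L X 1 \<sigma>"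
abbreviation off :: "nat \<times> nat \<Rightarrow> real" where "off \<equiv> lin 1 \<sigma>"

lemma shadow_eq: "shadow 1 \<sigma> = {0..1 + \<sigma>}"
  using sigma_pos by (simp add: shadow_def)

lemma off_eq: "off d = real (fst d) + \<sigma> * real (snd d)"
  by (simp add: lin_def)

lemma off_bounds:
  assumes "d \<in> cells L"
  shows "0 \<le> off d" "off d \<le> (real L - 1) * (1 + \<sigma>)"
proof -
  have "real (fst d) \<le> real L - 1" "real (snd d) \<le> real L - 1"
    using assms by (auto simp: cells_def)
  moreover from this(2) have "\<sigma> * real (snd d) \<le> \<sigma> * (real L - 1)"
    using sigma_pos by (intro mult_left_mono) auto
  ultimately show "0 \<le> off d" "off d \<le> (real L - 1) * (1 + \<sigma>)"
    using sigma_pos by (auto simp: off_eq algebra_simps)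
qed

lemma in_shadow_parent:
  assumes "d \<in> cells L" "real L * t - off d \<in> {0..1 + \<sigma>}"
  shows "t \<in> {0..1 + \<sigma>}"
proof -
  have "0 \<le> real L * t" "real L * t \<le> real L * (1 + \<sigma>)"
    using assms off_bounds[OF assms(1)] by (auto simp: algebra_simps)
  then show ?thesis
    using L_pos by (simp add: zero_le_mult_iff)
qed

lemma hit_prob_eq_0: "t \<notin> {0..1 + \<sigma>} \<Longrightarrow> p n t = 0"
proof (induction n arbitrary: t)
  case 0
  then show ?case by (simp add: shadow_eq)
next
  case (Suc n)
  have "p (Suc n) t = measure_pmf.expectation X (\<lambda>A. 0)"
    unfolding hit_prob.simps
  proof (rule expectation_cong)
    fix A assume "A \<in> set_pmf X"
    then have "p n (real L * t - off d) = 0" if "d \<in> A" for d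
      using Suc.IH Suc.prems in_shadow_parent[of d t] subset_cells that by blast
    then show "1 - (\<Prod>d\<in>A. 1 - p n (real L * t - off d)) = 0" by simp
  qed
  then show ?case by simp
qed

lemma integrable_if_bounded_support:
  fixes f :: "real \<Rightarrow> real"
  assumes "f \<in> borel_measurable borel" "\<And>t. \<bar>f t\<bar> \<le> indicator {0..1 + \<sigma>} t"
  shows "integrable lborel f"
  by (rule Bochner_Integration.integrable_bound[where f = "indicator {0..1 + \<sigma>} :: real \<Rightarrow> real"])
    (use assms sigma_pos in \<open>auto intro!: integrable_real_indicator\<close>)

lemma integral_le_2_if_bounded_support:
  fixes f :: "real \<Rightarrow> real"
  assumes "f \<in> borel_measurable borel" "\<And>t. \<bar>f t\<bar> \<le> indicator {0..1 + \<sigma>} t"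
  shows "(LBINT t. f t) \<le> 2"
proof -
  have "(LBINT t. f t) \<le> (LBINT t. indicator {0..1 + \<sigma>} t)"
    using assms sigma_pos
    by (intro integral_mono integrable_if_bounded_support integrable_real_indicator)
      (auto intro: order_trans[OF abs_ge_self])
  then show ?thesis using sigma_pos sigma_le_1 by simp
qed

lemma p_bounded_support: "\<bar>p n t\<bar> \<le> indicator {0..1 + \<sigma>} t"
  using hit_prob_eq_0[of t n] hit_prob_nonneg[of 1 \<sigma> n t] hit_prob_le_1[of 1 \<sigma> n t]
  by (auto simp: indicator_def)

lemma integrable_p: "integrable lborel (p n)"
  and integral_p_le_2: "(LBINT t. p n t) \<le> 2"
  using integrable_if_bounded_support[OF _ p_bounded_support[of n]]
    integral_le_2_if_bounded_support[OF _ p_bounded_support[of n]] by auto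

abbreviation g :: "real \<Rightarrow> real" where "g \<equiv> chord \<sigma>"

lemma g_bounds: "0 \<le> g t" "g t \<le> indicator {0..1 + \<sigma>} t"
proof -
  have "(t - 1) / \<sigma> \<le> t / \<sigma>" using sigma_pos by (simp add: divide_right_mono)
  then show "0 \<le> g t" by (auto simp: chord_def clamp01_def)
  show "g t \<le> indicator {0..1 + \<sigma>} t"
  proof (cases "t \<in> {0..1 + \<sigma>}")
    case False
    then have "t / \<sigma> \<le> 0 \<or> (t - 1) / \<sigma> \<ge> 1"
      using sigma_pos by (auto simp: field_simps)
    then show ?thesis using False \<open>(t - 1) / \<sigma> \<le> t / \<sigma>\<close> by (auto simp: chord_def clamp01_def)
  qed (auto simp: chord_def clamp01_def)
qed

lemma g_measurable [measurable]: "g \<in> borel_measurable borel"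
  unfolding chord_def[abs_def] clamp01_def by measurable

lemma g_bounded_support: "\<bar>g t\<bar> \<le> indicator {0..1 + \<sigma>} t"
  using g_bounds[of t] by simp

lemma integrable_g: "integrable lborel g"
  and integral_g_le_2: "(LBINT t. g t) \<le> 2"
  using integrable_if_bounded_support[OF _ g_bounded_support]
    integral_le_2_if_bounded_support[OF _ g_bounded_support] by auto

lemma integral_g_ge: "(LBINT t. g t) \<ge> 1 / 4"
proof -
  \<comment> \<open>For \<open>1/2 \<le> t \<le> 1\<close> the line meets the bottom side of the
    unit square and stays inside up to height \<open>min 1 (t / \<sigma>)\<close>, which is at least
    1/2.\<close>
  have "(LBINT t. indicator {1/2..1::real} t * (1 / 2)) \<le> (LBINT t. g t)"
  proof (rule integral_mono)
    show "indicator {1/2..1::real} t * (1 / 2) \<le> g t" for t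
    proof (cases "t \<in> {1/2..1}")
      case True
      then have "t / \<sigma> \<ge> 1 / 2" "(t - 1) / \<sigma> \<le> 0"
        using sigma_pos sigma_le_1 by (auto simp: field_simps)
      then have "clamp01 ((t - 1) / \<sigma>) = 0" "clamp01 (t / \<sigma>) \<ge> 1 / 2"
        unfolding clamp01_def by linarith+
      then show ?thesis using True by (simp add: chord_def)
    qed (use g_bounds in simp)
  qed (auto intro!: integrable_g integrable_divide_zero integrable_real_indicator emeasure_bounded_finite)
  then show ?thesis by simp
qed

text \<open>Subdividing the square does not change the total height of the line: inside a row the
  chords telescope from column to column, and \<open>sum_clamp01\<close> adds up the rows. Since
  each child is present with probability \<open>1 / L\<close>, \<open>g\<close> is a fixed point of
  the mean recursion, so the expected rescaled length of the line is \<open>g t\<close> at every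
  level.\<close>

lemma sum_g: "(\<Sum>d\<in>cells L. g (real L * t - off d)) = real L * g t"
proof -
  have "(\<Sum>d\<in>cells L. g (real L * t - off d)) =
     (\<Sum>i<L. \<Sum>j<L. g (real L * t - (real i + \<sigma> * real j)))"
    unfolding sum.cartesian_product by (simp add: cells_def off_eq case_prod_unfold)
  also have "\<dots> = (\<Sum>j<L. \<Sum>i<L. g (real L * t - (real i + \<sigma> * real j)))"
    by (rule sum.swap)
  also have "\<dots> = (\<Sum>j<L. clamp01 (real L * t / \<sigma> - real j) - clamp01 (real L * (t - 1) / \<sigma> - real j))"
  proof (rule sum.cong[OF refl])
    fix j :: nat
    define F where "F i = clamp01 ((real L * t - real i) / \<sigma> - real j)" for i
    have "g (real L * t - (real i + \<sigma> * real j)) = F i - F (Suc i)" for i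
    proof -
      have "(real L * t - (real i + \<sigma> * real j)) / \<sigma> = (real L * t - real i) / \<sigma> - real j"
        "(real L * t - (real i + \<sigma> * real j) - 1) / \<sigma> = (real L * t - real (Suc i)) / \<sigma> - real j"
        using sigma_pos by (simp_all add: field_simps)
      then show ?thesis unfolding chord_def F_def by (simp only:)
    qed
    then have "(\<Sum>i<L. g (real L * t - (real i + \<sigma> * real j))) = F 0 - F L"
      by (simp only: sum_lessThan_telescope')
    then show "(\<Sum>i<L. g (real L * t - (real i + \<sigma> * real j))) =
       clamp01 (real L * t / \<sigma> - real j) - clamp01 (real L * (t - 1) / \<sigma> - real j)"
      by (simp add: F_def right_diff_distrib)
  qed
  also have "\<dots> = max 0 (min (real L) (real L * t / \<sigma>)) - max 0 (min (real L) (real L * (t - 1) / \<sigma>))"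
    by (simp add: sum_subtractf sum_clamp01)
  also have "\<dots> = real L * g t"
  proof -
    have "max 0 (min (real L) (real L * x)) = real L * max 0 (min 1 x)" for x
    proof -
      consider "x \<le> 0" | "0 \<le> x" "x \<le> 1" | "1 \<le> x" by linarith
      then show ?thesis
      proof cases
        case 1
        then have "real L * x \<le> 0" by (simp add: mult_nonneg_nonpos)
        with 1 show ?thesis by simp
      next
        case 2
        then have "0 \<le> real L * x" "real L * x \<le> real L" by (simp_all add: mult_left_le)
        with 2 show ?thesis by simp
      next
        case 3
        then have "real L * 1 \<le> real L * x" by (intro mult_left_mono) auto
        with 3 show ?thesis by simp
      qed
    qed
    from this[of "t / \<sigma>"] this[of "(t - 1) / \<sigma>"] show ?thesis
      by (simp only: chord_def clamp01_def right_diff_distrib times_divide_eq_right)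
  qed
  finally show ?thesis .
qed

text \<open>Truncated inclusion-exclusion loses a second-order term at each level; \<open>overlap\<close> bounds it for
  pairs of squares in different columns, and \<open>correction\<close> accumulates it over the levels.\<close>

definition overlap :: "real \<Rightarrow> real" where
  "overlap t = (\<Sum>(d, d')\<in>{(d, d') \<in> cells L \<times> cells L. fst d \<noteq> fst d'}.
     indicator {0..1 + \<sigma>} (real L * t - off d) * indicator {0..1 + \<sigma>} (real L * t - off d'))"

primrec correction :: "nat \<Rightarrow> real \<Rightarrow> real" where
  "correction 0 t = 0"
| "correction (Suc n) t = (\<Sum>d\<in>cells L. correction n (real L * t - off d)) / real L + overlap t"

lemma finite_col_pairs [simp]: "finite {(d, d'). d \<in> cells L \<and> d' \<in> cells L \<and> fst d \<noteq> fst d'}"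
  by (rule finite_subset[of _ "cells L \<times> cells L"]) auto

lemma overlap_nonneg: "0 \<le> overlap t"
  unfolding overlap_def by (intro sum_nonneg) auto

text \<open>If \<open>d\<close> lies in an earlier column than \<open>d'\<close>, the shadow of
  \<open>d\<close> reaches beyond the start of that of \<open>d'\<close> only because the line is
  tilted: by at most \<open>\<sigma> L\<close>, hence \<open>\<sigma>\<close> after division by
  \<open>L\<close>. The factor \<open>L ^ 4\<close> bounds the number of pairs.\<close>

lemma integral_overlap:
  "integrable lborel overlap" "(LBINT t. overlap t) \<le> real L ^ 4 * \<sigma>"
proof -
  let ?P = "{(d, d') \<in> cells L \<times> cells L. fst d \<noteq> fst d'}"
  define f where "f = (\<lambda>d d' t. indicator {0..1 + \<sigma>} (real L * t - off d) *
     indicator {0..1 + \<sigma>} (real L * t - off d') :: real)"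
  have f_comm: "f d d' = f d' d" for d d'
    by (simp add: f_def mult.commute)
  have main: "integrable lborel (f d d') \<and> (LBINT t. f d d' t) \<le> \<sigma>"
    if d: "d \<in> cells L" "d' \<in> cells L" "fst d < fst d'" for d d'
  proof -
    let ?a = "off d' / real L" and ?b = "(off d + 1 + \<sigma>) / real L"
    have "real (fst d) + 1 \<le> real (fst d')" using d by linarith
    moreover have "real (snd d) + 1 \<le> real L" using d by (auto simp: cells_def)
    then have "\<sigma> * (real (snd d) + 1) \<le> \<sigma> * real L"
      using sigma_pos by (intro mult_left_mono) auto
    moreover have "0 \<le> \<sigma> * real (snd d')" using sigma_pos by simp
    ultimately have "off d + 1 + \<sigma> - off d' \<le> \<sigma> * real L"
      by (simp add: off_eq algebra_simps)
    then have ab: "?b - ?a \<le> \<sigma>"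
      using L_pos by (simp add: diff_divide_distrib[symmetric] pos_divide_le_eq)
    have f: "f d d' t \<le> indicator {?a..?b} t" for t
    proof (cases "t \<in> {?a..?b}")
      case False
      then have "\<not> (off d' \<le> real L * t \<and> real L * t \<le> off d + 1 + \<sigma>)"
        using L_pos by (simp add: pos_divide_le_eq pos_le_divide_eq mult.commute)
      then show ?thesis by (auto simp: f_def indicator_def)
    qed (simp add: f_def indicator_def)
    have int: "integrable lborel (f d d')"
    proof (rule integrable_if_bounded_support)
      show "f d d' \<in> borel_measurable borel"
        unfolding f_def by measurable
      show "\<bar>f d d' t\<bar> \<le> indicator {0..1 + \<sigma>} t" for t
        using in_shadow_parent[OF d(1), of t] by (simp add: f_def indicator_def)
    qed
    have "(LBINT t. f d d' t) \<le> (LBINT t. indicator {?a..?b} t)"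
      by (rule integral_mono[OF int _ f]) (auto intro!: integrable_real_indicator simp: emeasure_lborel_Icc_eq)
    also have "\<dots> \<le> \<sigma>"
      using ab sigma_pos by (simp add: measure_def emeasure_lborel_Icc_eq)
    finally show ?thesis using int by blast
  qed
  have I: "integrable lborel (case_prod f q) \<and> (LBINT t. case_prod f q t) \<le> \<sigma>" if q: "q \<in> ?P" for q
  proof -
    obtain d d' where dd: "q = (d, d')" "d \<in> cells L" "d' \<in> cells L" "fst d \<noteq> fst d'"
      using q by auto
    then have "fst d < fst d' \<or> fst d' < fst d" by linarith
    then show ?thesis
    proof
      assume "fst d < fst d'"
      from main[OF dd(2,3) this] show ?thesis by (simp add: dd(1))
    next
      assume "fst d' < fst d"
      from main[OF dd(3,2) this] show ?thesis by (simp add: dd(1) f_comm[of d d'])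
    qed
  qed
  have ov: "overlap = (\<lambda>t. \<Sum>q\<in>?P. case_prod f q t)"
    by (rule ext) (simp add: overlap_def f_def case_prod_unfold)
  show "integrable lborel overlap"
    unfolding ov by (rule Bochner_Integration.integrable_sum) (rule I[THEN conjunct1])
  have "(LBINT t. overlap t) = (\<Sum>q\<in>?P. LBINT t. case_prod f q t)"
    unfolding ov by (rule Bochner_Integration.integral_sum) (rule I[THEN conjunct1])
  also have "\<dots> \<le> (\<Sum>q\<in>?P. \<sigma>)"
    by (rule sum_mono) (rule I[THEN conjunct2])
  also have "\<dots> = real (card ?P) * \<sigma>"
    by (rule sum_constant)
  also have "\<dots> \<le> real L ^ 4 * \<sigma>"
  proof -
    have "card ?P \<le> card (cells L \<times> cells L)"
      by (rule card_mono) auto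
    also have "\<dots> = L ^ 4"
      by (simp add: card_cells card_cartesian_product power4_eq_xxxx)
    finally have "real (card ?P) \<le> real (L ^ 4)"
      by (simp only: of_nat_le_iff)
    then have "real (card ?P) \<le> real L ^ 4"
      by (simp only: of_nat_power)
    then show ?thesis
      using sigma_pos by (intro mult_right_mono) auto
  qed
  finally show "(LBINT t. overlap t) \<le> real L ^ 4 * \<sigma>" .
qed

lemma correction_nonneg: "0 \<le> correction n t"
  by (induction n arbitrary: t) (auto intro!: add_nonneg_nonneg sum_nonneg divide_nonneg_nonneg overlap_nonneg)

text \<open>Averaging over the children preserves integrals: there are \<open>L\<^sup>2\<close>
  terms, one factor \<open>1 / L\<close> from the mean and one from the change of variables. So each
  level adds the integral of one \<open>overlap\<close>.\<close>

lemma integral_correction: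
  "integrable lborel (correction n) \<and> (LBINT t. correction n t) \<le> real n * (real L ^ 4 * \<sigma>)"
proof (induction n)
  case 0
  then show ?case by simp
next
  case (Suc n)
  have int: "integrable lborel (\<lambda>t. correction n (real L * t - c))" for c
    using Suc L_pos by (intro integrable_affine_shift) auto
  then have int': "integrable lborel (\<lambda>t. (\<Sum>d\<in>cells L. correction n (real L * t - off d)) / real L)"
    by (intro integrable_divide_zero Bochner_Integration.integrable_sum) auto
  have "(LBINT t. correction (Suc n) t) =
     (LBINT t. (\<Sum>d\<in>cells L. correction n (real L * t - off d)) / real L) + (LBINT t. overlap t)"
    using int' integral_overlap by simp
  also have "(LBINT t. (\<Sum>d\<in>cells L. correction n (real L * t - off d)) / real L) =
      (\<Sum>d\<in>cells L. LBINT t. correction n (real L * t - off d)) / real L"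
    using int by simp
  also have "\<dots> = (LBINT t. correction n t)"
    using L_pos by (simp add: integral_affine_shift card_cells)
  finally show ?case
    using Suc int' integral_overlap by (auto simp: algebra_simps)
qed

text \<open>The free factor \<open>a\<close> is the point: with \<open>a = 1\<close> the correction,
  whose integral is only bounded by a multiple of \<sigma> n, could swamp the first-order term,
  while scaling the trial bound by \<open>a\<close> scales the pair terms by
  \<open>a\<^sup>2\<close>.\<close>

lemma hit_prob_ge:
  assumes columns: "\<And>A. A \<in> set_pmf X \<Longrightarrow> inj_on fst A" and a: "0 \<le> a" "a \<le> 1"
  shows "a * g t - a\<^sup>2 * correction n t \<le> p n t"
proof (induction n arbitrary: t)
  case 0
  have "a * g t \<le> 1 * indicator {0..1 + \<sigma>} t"
    using a g_bounds by (intro mult_mono) auto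
  then show ?case by (simp add: shadow_eq)
next
  case (Suc n)
  define s where "s d = real L * t - off d" for d
  \<comment> \<open>The trial bound may be negative, whereas inclusion-exclusion needs values in
    [0, 1]. The truncation stays below both the hitting probability and \<open>a\<close> times the
    indicator of the shadow.\<close>
  define y where "y d = max 0 (a * g (s d) - a\<^sup>2 * correction n (s d))" for d
  have y_le: "y d \<le> a * indicator {0..1 + \<sigma>} (s d)" for d
  proof -
    have "a * g (s d) - a\<^sup>2 * correction n (s d) \<le> a * g (s d)"
      by (simp add: correction_nonneg)
    also have "\<dots> \<le> a * indicator {0..1 + \<sigma>} (s d)"
      using a g_bounds by (intro mult_left_mono) auto
    finally show ?thesis using a by (simp add: y_def)
  qed
  have y: "0 \<le> y d" "y d \<le> p n (s d)" for d
    using Suc[of "s d"] hit_prob_nonneg[of 1 \<sigma> n "s d"] by (auto simp: y_def)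
  then have y_le_1: "y d \<le> 1" for d
    using hit_prob_le_1[of 1 \<sigma> n "s d"] by (meson order_trans)
  have sample: "(\<Sum>d\<in>A. a * g (s d) - a\<^sup>2 * correction n (s d)) - a\<^sup>2 * overlap t
      \<le> 1 - (\<Prod>d\<in>A. 1 - p n (s d))" if A: "A \<in> set_pmf X" for A
  proof -
    have yy: "y d * y d' \<le> a\<^sup>2 * (indicator {0..1 + \<sigma>} (s d) * indicator {0..1 + \<sigma>} (s d'))" for d d'
    proof -
      have "y d * y d' \<le> (a * indicator {0..1 + \<sigma>} (s d)) * (a * indicator {0..1 + \<sigma>} (s d'))"
        using y y_le a by (intro mult_mono) auto
      then show ?thesis
        by (simp add: power2_eq_square mult_ac)
    qed
    have "(\<Sum>d\<in>A. \<Sum>d'\<in>A - {d}. y d * y d') = (\<Sum>(d, d')\<in>(SIGMA d:A. A - {d}). y d * y d')"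
      using finite_sample[OF A] by (intro sum.Sigma) auto
    also have "\<dots> \<le> (\<Sum>(d, d')\<in>(SIGMA d:A. A - {d}).
        a\<^sup>2 * (indicator {0..1 + \<sigma>} (s d) * indicator {0..1 + \<sigma>} (s d')))"
      unfolding case_prod_unfold by (rule sum_mono) (rule yy)
    also have "\<dots> \<le> (\<Sum>(d, d')\<in>{(d, d') \<in> cells L \<times> cells L. fst d \<noteq> fst d'}.
        a\<^sup>2 * (indicator {0..1 + \<sigma>} (s d) * indicator {0..1 + \<sigma>} (s d')))"
      \<comment> \<open>Degeneracy enters here: two squares of one sample lie in different columns,
        so the pair occurs in \<open>overlap\<close>.\<close>
      using subset_cells[OF A] columns[OF A]
      by (intro sum_mono2) (auto simp: inj_on_def)
    also have "\<dots> = a\<^sup>2 * overlap t"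
      by (simp add: overlap_def s_def sum_distrib_left case_prod_unfold)
    finally have "(\<Sum>d\<in>A. \<Sum>d'\<in>A - {d}. y d * y d') \<le> a\<^sup>2 * overlap t" .
    moreover have "(\<Sum>d\<in>A. y d) - (\<Sum>d\<in>A. \<Sum>d'\<in>A - {d}. y d * y d') \<le> 1 - (\<Prod>d\<in>A. 1 - y d)"
      using y y_le_1 by (intro sum_minus_pairs_le_1_minus_prod finite_sample[OF A]) auto
    moreover have "(\<Prod>d\<in>A. 1 - p n (s d)) \<le> (\<Prod>d\<in>A. 1 - y d)"
      using y hit_prob_le_1 by (intro prod_mono) auto
    moreover have "(\<Sum>d\<in>A. a * g (s d) - a\<^sup>2 * correction n (s d)) \<le> (\<Sum>d\<in>A. y d)"
      by (intro sum_mono) (simp add: y_def)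
    ultimately show ?thesis by linarith
  qed
  have "(\<Sum>d\<in>cells L. a * g (s d) - a\<^sup>2 * correction n (s d)) / real L - a\<^sup>2 * overlap t =
     measure_pmf.expectation X (\<lambda>A. (\<Sum>d\<in>A. a * g (s d) - a\<^sup>2 * correction n (s d)) - a\<^sup>2 * overlap t)"
    by (subst Bochner_Integration.integral_diff) (simp_all add: expectation_sum)
  also have "\<dots> \<le> p (Suc n) t"
    unfolding hit_prob.simps s_def[symmetric] by (rule expectation_mono) (rule sample)
  also have "(\<Sum>d\<in>cells L. a * g (s d) - a\<^sup>2 * correction n (s d)) / real L =
      a * g t - a\<^sup>2 * (\<Sum>d\<in>cells L. correction n (s d)) / real L"
    using L_pos by (simp add: sum_subtractf sum_distrib_left[symmetric] s_def sum_g diff_divide_distrib)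
  finally show ?case
    by (simp add: s_def algebra_simps)
qed

lemma integral_hit_prob_ge:
  assumes columns: "\<And>A. A \<in> set_pmf X \<Longrightarrow> inj_on fst A"
  shows "(LBINT t. p n t) \<ge> 1 / (8 * (1 + 8 * real L ^ 4 * (\<sigma> * real n)))"
proof -
  define b where "b = real L ^ 4 * (\<sigma> * real n)"
  \<comment> \<open>Chosen so that \<open>a * b \<le> 1/8\<close>, half of the lower bound 1/4 for
    the integral of \<open>g\<close>.\<close>
  define a where "a = 1 / (1 + 8 * b)"
  have b: "0 \<le> b" using sigma_pos by (simp add: b_def)
  then have a: "0 < a" "a \<le> 1" "a * b \<le> 1 / 8" by (auto simp: a_def field_simps)
  have "a * (1 / 8) \<le> a * (1 / 4 - a * b)"
    using a by (intro mult_left_mono) auto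
  also have "\<dots> = a * (1 / 4) - a\<^sup>2 * b"
    by (simp add: power2_eq_square algebra_simps)
  also have "\<dots> \<le> a * (LBINT t. g t) - a\<^sup>2 * (LBINT t. correction n t)"
    using integral_g_ge integral_correction[of n] a
    by (intro diff_mono mult_left_mono) (auto simp: b_def mult_ac)
  also have "\<dots> = (LBINT t. a * g t - a\<^sup>2 * correction n t)"
    using integrable_g integral_correction[of n] by simp
  also have "\<dots> \<le> (LBINT t. p n t)"
    using integrable_g integral_correction[of n] integrable_p a
    by (intro integral_mono hit_prob_ge columns) auto
  finally show ?thesis by (simp add: a_def b_def mult_ac)
qed

end

section \<open>Upper bound for steep lines\<close>

context steep_lines
begin

text \<open>The column in which the line \<open>x + \<sigma> y = L - 1 + 3 \<sigma> / 4\<close>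
  crosses height \<open>j + 1/2\<close>; hence the term
  \<open>\<sigma> / 4 = 3 \<sigma> / 4 - \<sigma> / 2\<close>.\<close>

definition chain_col :: "nat \<Rightarrow> nat" where
  "chain_col j = nat \<lfloor>real L - 1 + \<sigma> / 4 - \<sigma> * real j\<rfloor>"

text \<open>The line \<open>L t = L - 1 + 3 \<sigma> / 4\<close> meets a square in every row at mid-height, and moreover the
  square \<open>(L - 2, 0)\<close>: one square more than a sample contains on average.\<close>

definition chain :: "(nat \<times> nat) set" where
  "chain = insert (L - 2, 0) ((\<lambda>j. (chain_col j, j)) ` {..<L})"

lemma chain_col:
  assumes "j < L"
  defines "x \<equiv> real L - 1 + \<sigma> / 4 - \<sigma> * real j - real (chain_col j)"
  shows "0 \<le> x" "x < 1" "chain_col j < L" "j > 0 \<Longrightarrow> chain_col j < L - 1"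
    "j = 0 \<Longrightarrow> chain_col j = L - 1"
proof -
  let ?z = "real L - 1 + \<sigma> / 4 - \<sigma> * real j"
  have "\<sigma> * real j \<le> 1 * real j" using sigma_le_1 by (intro mult_right_mono) auto
  then have z: "0 \<le> ?z" using assms(1) sigma_pos by linarith
  then have r: "real (chain_col j) = of_int \<lfloor>?z\<rfloor>" by (simp add: chain_col_def)
  then show x: "0 \<le> x" "x < 1" unfolding x_def by linarith+
  have "0 \<le> \<sigma> * real j" using sigma_pos by simp
  then have "?z < real L" using sigma_le_1 by linarith
  then have "real (chain_col j) < real L" using x unfolding x_def by linarith
  then show "chain_col j < L" by simp
  show "chain_col j < L - 1" if "j > 0"
  proof -
    have "\<sigma> * 1 \<le> \<sigma> * real j" using that sigma_pos by (intro mult_left_mono) auto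
    then have "?z < real L - 1" using sigma_pos by linarith
    then have "real (chain_col j) < real L - 1" using x unfolding x_def by linarith
    then show ?thesis by linarith
  qed
  show "chain_col j = L - 1" if "j = 0"
  proof -
    have "\<lfloor>?z\<rfloor> = int (L - 1)"
      using that sigma_pos sigma_le_1 L_ge_2 by (intro floor_unique) (auto simp: of_nat_diff)
    then show ?thesis by (simp add: chain_col_def)
  qed
qed

lemma chain_subset: "chain \<subseteq> cells L"
  using chain_col(3) L_ge_2 by (auto simp: chain_def cells_def)

lemma finite_chain [simp]: "finite chain"
  by (simp add: chain_def)

lemma card_chain: "card chain = L + 1"
proof -
  have "(L - 2, 0) \<notin> (\<lambda>j. (chain_col j, j)) ` {..<L}"
    using chain_col(5)[of 0] L_ge_2 by auto
  then show ?thesis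
    by (simp add: chain_def card_image inj_on_def)
qed

text \<open>In rows \<open>j > 0\<close> the crossing at mid-height lies left of
  \<open>L - 1\<close>, so \<open>(L - 1, 0)\<close> is the only candidate. Consequently one member
  of any pair in the chain avoids the last column.\<close>

lemma chain_last_column:
  assumes "d \<in> chain" "d' \<in> chain" "fst d = L - 1" "fst d' = L - 1"
  shows "d = d'"
proof -
  have "e = (L - 1, 0)" if "e \<in> chain" "fst e = L - 1" for e
    using that chain_col(4,5) L_ge_2 by (auto simp: chain_def) (metis gr0I less_irrefl)+
  then show ?thesis using assms by metis
qed

text \<open>In row 0 the line passes from column \<open>L - 1\<close> to column \<open>L - 2\<close>
  at height \<open>y\<close>, and \<open>y \<le> 7/8\<close> leaves at least 1/8 above it. In
  general \<open>y\<close> differs from 3/4 by at most 1/8, so each row's square still contains a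
  point of the line within 1/8 of mid-height; as \<open>\<sigma> \<le> 1\<close> makes the line
  steep, it keeps height at least 1/8 there.\<close>

lemma g_chain:
  assumes "d \<in> chain" "5/8 \<le> y" "y \<le> 7/8"
  shows "g (real L - 1 + \<sigma> * y - off d) \<ge> 1/8"
proof -
  have clamp: "clamp01 u = 1" if "u \<ge> 1" for u using that by (simp add: clamp01_def)
  have clamp0: "clamp01 u = 0" if "u \<le> 0" for u using that by (simp add: clamp01_def)
  consider "d = (L - 2, 0)" | j where "j < L" "d = (chain_col j, j)"
    using assms(1) by (auto simp: chain_def)
  then show ?thesis
  proof cases
    case 1
    have eq: "real L - 1 + \<sigma> * y - off d = 1 + \<sigma> * y"
      using 1 L_ge_2 by (simp add: off_eq of_nat_diff)
    have "(1 + \<sigma> * y) / \<sigma> \<ge> 1"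
    proof -
      have "0 \<le> \<sigma> * y" using sigma_pos assms by simp
      then have "\<sigma> \<le> 1 + \<sigma> * y" using sigma_le_1 by linarith
      then show ?thesis using sigma_pos by simp
    qed
    moreover have "(1 + \<sigma> * y - 1) / \<sigma> = y" using sigma_pos by simp
    ultimately show ?thesis
      unfolding eq chord_def using assms by (simp add: clamp) (simp add: clamp01_def)
  next
    case 2
    define x where "x = real L - 1 + \<sigma> / 4 - \<sigma> * real j - real (chain_col j)"
    have x: "0 \<le> x" "x < 1" using chain_col[OF 2(1)] by (simp_all add: x_def)
    have eq: "real L - 1 + \<sigma> * y - off d = x + \<sigma> * (y - 1/4)"
      by (simp add: off_eq 2 x_def algebra_simps)
    define v where "v = x / \<sigma>"
    have v: "0 \<le> v" using x sigma_pos by (simp add: v_def)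
    have 1: "(x + \<sigma> * (y - 1/4)) / \<sigma> = v + (y - 1/4)"
      using sigma_pos by (simp add: v_def field_simps)
    have "1 \<le> 1 / \<sigma>" using sigma_pos sigma_le_1 by simp
    moreover have "(x - 1) / \<sigma> = v - 1 / \<sigma>" by (simp add: v_def diff_divide_distrib)
    moreover have "(x - 1) / \<sigma> < 0" using x sigma_pos by (simp add: divide_neg_pos)
    ultimately have w: "(x - 1) / \<sigma> \<le> v - 1" "(x - 1) / \<sigma> \<le> 0" by auto
    have 2: "(x + \<sigma> * (y - 1/4) - 1) / \<sigma> = (x - 1) / \<sigma> + (y - 1/4)"
      using sigma_pos by (simp add: field_simps)
    have mono: "clamp01 u \<le> clamp01 u'" if "u \<le> u'" for u u'
      using that unfolding clamp01_def by linarith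
    have "clamp01 ((x - 1) / \<sigma> + (y - 1/4)) \<le> clamp01 (min v 1 - 1 + (y - 1/4))"
      using w by (intro mono) linarith
    moreover have "clamp01 (min v 1 - 1 + (y - 1/4)) + 1/8 \<le> clamp01 (v + (y - 1/4))"
      using v assms unfolding clamp01_def by linarith
    ultimately show ?thesis
      unfolding eq chord_def 1 2 by linarith
  qed
qed

text \<open>By uniformity the number N of chain squares in a sample has mean (L + 1) / L, so N (N -
  1) \<ge> N - 1 has mean at least 1 / L. This is shared by (L + 1) L ordered pairs, and L + 1 \<le>
  4 L gives the constant. Exchanging the two squares if necessary puts \<open>c\<close> outside the
  last column.\<close>

lemma exists_chain_pair:
  obtains c c' where "c \<in> chain" "c' \<in> chain" "c \<noteq> c'" "fst c \<noteq> L - 1"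
    "1 / (4 * real L ^ 3) \<le> measure_pmf.prob X {A. c \<in> A \<and> c' \<in> A}"
proof -
  let ?P = "\<lambda>d d'. measure_pmf.prob X {A. d \<in> A \<and> d' \<in> A}"
  let ?i = "\<lambda>d A. indicator A d :: real"
  have "(real L + 1) / real L - 1 = measure_pmf.expectation X (\<lambda>A. (\<Sum>d\<in>A. indicator chain d) - 1)"
  proof -
    have "(\<Sum>d\<in>cells L. indicator chain d) = real L + 1"
      using chain_subset card_chain by (simp add: sum.If_cases indicator_def Int_absorb1)
    then show ?thesis
      by (subst Bochner_Integration.integral_diff) (simp_all add: expectation_sum)
  qed
  also have "\<dots> \<le> measure_pmf.expectation X (\<lambda>A. \<Sum>d\<in>chain. \<Sum>d'\<in>chain - {d}. ?i d A * ?i d' A)"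
  proof (rule expectation_mono)
    fix A assume A: "A \<in> set_pmf X"
    define N where "N = (\<Sum>d\<in>chain. ?i d A)"
    have "(\<Sum>d\<in>A. indicator chain d) = N"
      using finite_sample[OF A] by (simp add: N_def sum.If_cases indicator_def Int_commute)
    moreover have "(\<Sum>d\<in>chain. \<Sum>d'\<in>chain - {d}. ?i d A * ?i d' A) = (\<Sum>d\<in>chain. ?i d A * (N - ?i d A))"
      by (intro sum.cong) (simp_all add: N_def sum_distrib_left[symmetric] sum_diff1)
    moreover have "\<dots> = (\<Sum>d\<in>chain. ?i d A * N - ?i d A)"
      by (intro sum.cong) (auto simp: indicator_def)
    moreover have "\<dots> = N * N - N"
      by (simp add: sum_subtractf N_def sum_distrib_right)
    moreover have "0 \<le> (N - 1) * (N - 1)" by simp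
    ultimately show "(\<Sum>d\<in>A. indicator chain d) - 1 \<le> (\<Sum>d\<in>chain. \<Sum>d'\<in>chain - {d}. ?i d A * ?i d' A)"
      by (simp add: algebra_simps)
  qed
  also have "\<dots> = (\<Sum>d\<in>chain. \<Sum>d'\<in>chain - {d}. ?P d d')"
  proof -
    have "measure_pmf.expectation X (\<lambda>A. ?i d A * ?i d' A) = ?P d d'" for d d'
    proof -
      have "(\<lambda>A. ?i d A * ?i d' A) = indicator {A. d \<in> A \<and> d' \<in> A}"
        by (auto simp: indicator_def)
      then show ?thesis by simp
    qed
    then show ?thesis
      by (simp only: Bochner_Integration.integral_sum integrable_X)
  qed
  finally have lower: "1 / real L \<le> (\<Sum>d\<in>chain. \<Sum>d'\<in>chain - {d}. ?P d d')"
    using L_pos by (simp add: field_simps)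
  have "\<exists>d\<in>chain. \<exists>d'\<in>chain - {d}. 1 / (4 * real L ^ 3) \<le> ?P d d'"
  proof (rule ccontr)
    assume "\<not> ?thesis"
    then have small: "?P d d' < 1 / (4 * real L ^ 3)" if "d \<in> chain" "d' \<in> chain - {d}" for d d'
      using that by (meson not_le)
    have card: "card (chain - {d}) = L" if "d \<in> chain" for d
      using that card_chain by simp
    have inner: "(\<Sum>d'\<in>chain - {d}. ?P d d') < real L * (1 / (4 * real L ^ 3))" if "d \<in> chain" for d
    proof -
      have "(\<Sum>d'\<in>chain - {d}. ?P d d') < (\<Sum>d'\<in>chain - {d}. 1 / (4 * real L ^ 3))"
      proof (rule sum_strict_mono)
        show "chain - {d} \<noteq> {}" using card[OF that] L_pos by (metis card.empty less_irrefl)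
      qed (use small that in auto)
      then show ?thesis using card[OF that] by simp
    qed
    have "(\<Sum>d\<in>chain. \<Sum>d'\<in>chain - {d}. ?P d d') < (\<Sum>d\<in>chain. real L * (1 / (4 * real L ^ 3)))"
      using inner by (intro sum_strict_mono) (auto simp: chain_def)
    also have "\<dots> = (real L + 1) / (4 * real L ^ 2)"
      using L_pos by (simp add: card_chain power2_eq_square power3_eq_cube)
    also have "\<dots> \<le> 1 / real L"
    proof -
      have "(real L + 1) * real L \<le> (4 * real L) * real L"
        using L_real by (intro mult_right_mono) auto
      then show ?thesis using L_pos by (simp add: field_simps power2_eq_square)
    qed
    finally show False using lower by simp
  qed
  then obtain d d' where d: "d \<in> chain" "d' \<in> chain" "d \<noteq> d'" "1 / (4 * real L ^ 3) \<le> ?P d d'"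
    by auto
  have "?P d' d = ?P d d'" by (simp add: conj_commute)
  moreover have "fst d \<noteq> L - 1 \<or> fst d' \<noteq> L - 1"
    using chain_last_column d by blast
  ultimately show ?thesis using d that[of d d'] that[of d' d] by auto
qed

end

text \<open>\<open>thinned c n t\<close> is the expected sum of \<open>exp (- G)\<close> over the squares of \<open>S\<^sub>n\<close> met by the line, where
  \<open>G\<close> counts the ancestors at which the child \<open>c\<close> is taken while the line is in \<open>good\<close> position. With \<open>c\<close>
  first in the exploration order, its partner \<open>c'\<close> in the chain is still unexplored at each of them.\<close>

context steep_lines
begin

text \<open>The range of lines in \<open>g_chain\<close>, pulled back by the factor
  \<open>L\<close>: for these every chain square carries a chord of height at least 1/8.\<close>

definition good :: "real set" where
  "good = {(real L - 1 + \<sigma> * (5/8)) / real L .. (real L - 1 + \<sigma> * (7/8)) / real L}"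

primrec thinned :: "nat \<times> nat \<Rightarrow> nat \<Rightarrow> real \<Rightarrow> real" where
  "thinned c 0 t = indicator {0..1 + \<sigma>} t"
| "thinned c (Suc n) t =
     ((\<Sum>d\<in>cells L. thinned c n (real L * t - off d))
        - (1 - exp (-1)) * (indicator good t * thinned c n (real L * t - off c))) / real L"

lemma goodE:
  assumes "t \<in> good"
  obtains y where "5/8 \<le> y" "y \<le> 7/8" "real L * t = real L - 1 + \<sigma> * y"
proof (rule that)
  let ?y = "(real L * t - (real L - 1)) / \<sigma>"
  have "real L - 1 + \<sigma> * (5/8) \<le> real L * t" "real L * t \<le> real L - 1 + \<sigma> * (7/8)"
    using assms L_pos by (auto simp: good_def pos_divide_le_eq pos_le_divide_eq mult.commute)
  then show "5/8 \<le> ?y" "?y \<le> 7/8" "real L * t = real L - 1 + \<sigma> * ?y"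
    using sigma_pos by (simp_all add: pos_le_divide_eq pos_divide_le_eq mult.commute)
qed

text \<open>Only the child \<open>c\<close> is ever thinned, so a family of children avoiding it
  keeps its full weight, while any other family loses at most the factor
  \<open>exp (-1)\<close>.\<close>

lemma thinned_step_ge:
  assumes c: "c \<in> cells L" and nonneg: "\<And>t. 0 \<le> thinned c n t" and J: "J \<subseteq> cells L"
  shows "c \<notin> J \<Longrightarrow> (\<Sum>d\<in>J. thinned c n (real L * t - off d)) / real L \<le> thinned c (Suc n) t"
    and "exp (-1) * ((\<Sum>d\<in>J. thinned c n (real L * t - off d)) / real L) \<le> thinned c (Suc n) t"
proof -
  define B where "B d = thinned c n (real L * t - off d)" for d
  have B: "0 \<le> B d" for d using nonneg by (simp add: B_def)
  define \<delta> where "\<delta> = (1 - exp (-1)) * (indicator good t :: real)"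
  have \<delta>: "0 \<le> \<delta>" "\<delta> \<le> 1 - exp (-1)" "\<delta> \<le> 1" by (auto simp: \<delta>_def indicator_def)
  have fJ: "finite J" using J finite_subset finite_cells by blast
  have S: "thinned c (Suc n) t = ((\<Sum>d\<in>cells L. B d) - \<delta> * B c) / real L"
    by (simp add: B_def \<delta>_def mult.assoc)
  have le: "(\<Sum>d\<in>I. B d) \<le> (\<Sum>d\<in>cells L. B d)" if "I \<subseteq> cells L" for I
    using that B by (intro sum_mono2) auto
  have Bc: "\<delta> * B c \<le> B c" using \<delta> B[of c] by (simp add: mult_left_le_one_le)
  show "(\<Sum>d\<in>J. thinned c n (real L * t - off d)) / real L \<le> thinned c (Suc n) t" if "c \<notin> J"
  proof -
    have "(\<Sum>d\<in>J. B d) + B c \<le> (\<Sum>d\<in>cells L. B d)"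
      using le[of "insert c J"] c J fJ that by simp
    then have "(\<Sum>d\<in>J. B d) \<le> (\<Sum>d\<in>cells L. B d) - \<delta> * B c" using Bc by linarith
    then show ?thesis unfolding S B_def[symmetric] by (simp add: divide_right_mono)
  qed
  have "exp (-1) * (\<Sum>d\<in>J. B d) \<le> exp (-1) * (\<Sum>d\<in>cells L. B d)"
    using le[OF J] by simp
  also have "\<dots> \<le> (1 - \<delta>) * (\<Sum>d\<in>cells L. B d)"
    using \<delta> B by (intro mult_right_mono sum_nonneg) auto
  also have "\<dots> \<le> (\<Sum>d\<in>cells L. B d) - \<delta> * B c"
    using mult_left_mono[OF member_le_sum[of c "cells L" B] \<delta>(1)] c B by (simp add: algebra_simps)
  finally show "exp (-1) * ((\<Sum>d\<in>J. thinned c n (real L * t - off d)) / real L) \<le> thinned c (Suc n) t"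
    unfolding S B_def[symmetric] by (simp add: divide_right_mono)
qed

lemma thinned_nonneg: "c \<in> cells L \<Longrightarrow> 0 \<le> thinned c n t"
proof (induction n arbitrary: t)
  case (Suc n)
  then show ?case using thinned_step_ge(2)[of c n "{}" t] by simp
qed simp

lemma thinned_eq_0:
  assumes "c \<in> cells L" "t \<notin> {0..1 + \<sigma>}"
  shows "thinned c n t = 0"
  using assms(2)
proof (induction n arbitrary: t)
  case (Suc n)
  then have "thinned c n (real L * t - off d) = 0" if "d \<in> cells L" for d
    using in_shadow_parent[OF that] by blast
  then show ?case using assms(1) by simp
qed simp

text \<open>At a good position with \<open>c\<close> in the sample, \<open>c\<close> is explored
  first. If it is hit, \<open>k - 1\<close> is paid by induction at \<open>c\<close>, which yields
  the factor \<open>exp (-1)\<close> in \<open>thinned\<close>, and the last unit is paid by the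
  chord of the unexplored \<open>c'\<close>. The constant balances this in expectation:
  \<open>32 L\<^sup>2 * 1/8 * 1 / (4 L ^ 3) = 1 / L\<close>, the probability of \<open>c\<close>.
  The budget drops along the induction and may become negative, so \<open>k\<close> ranges over all
  reals.\<close>

lemma hit_prob_le:
  assumes c: "c \<in> cells L" "c' \<in> cells L" "c \<noteq> c'"
    and pair: "1 / (4 * real L ^ 3) \<le> measure_pmf.prob X {A. c \<in> A \<and> c' \<in> A}"
    and g: "\<And>t. t \<in> good \<Longrightarrow> g (real L * t - off c') \<ge> 1/8"
  shows "k * p n t \<le> 32 * real L ^ 2 * g t + exp k * thinned c n t"
proof (induction n arbitrary: k t)
  case 0
  have "k \<le> exp k" using exp_ge_add_one_self[of k] by linarith
  then have "k * indicator {0..1 + \<sigma>} t \<le> exp k * indicator {0..1 + \<sigma>} t"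
    by (intro mult_right_mono) auto
  then show ?case using g_bounds[of t] by (simp add: shadow_eq add_increasing)
next
  case (Suc n)
  define K where "K = 32 * real L ^ 2"
  have K: "0 \<le> K" by (simp add: K_def)
  show ?case
  proof (cases "k \<ge> 0")
    case False
    then have "k * p (Suc n) t \<le> 0"
      using hit_prob_nonneg[of 1 \<sigma> "Suc n" t] by (intro mult_nonpos_nonneg) auto
    also have "\<dots> \<le> K * g t + exp k * thinned c (Suc n) t"
      using K g_bounds[of t] thinned_nonneg[OF c(1), of "Suc n" t]
      by (intro add_nonneg_nonneg mult_nonneg_nonneg) auto
    finally show ?thesis by (simp only: K_def)
  next
    case k: True
    define s where "s d = real L * t - off d" for d
    define P where "P d = p n (s d)" for d
    define G where "G d = g (s d)" for d
    define B where "B d = thinned c n (s d)" for d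
    define \<omega> where "\<omega> d = (if d = c \<and> t \<in> good then exp (-1) else 1 :: real)" for d
    have P: "0 \<le> P d" "P d \<le> 1" for d
      using hit_prob_nonneg hit_prob_le_1 by (auto simp: P_def)
    have G: "0 \<le> G d" for d using g_bounds by (simp add: G_def)
    have B: "0 \<le> B d" for d using thinned_nonneg[OF c(1)] by (simp add: B_def)
    have IH: "l * P d \<le> K * G d + exp l * B d" for l d
      using Suc[of l "s d"] by (simp only: P_def G_def B_def K_def)
    have union: "1 - (\<Prod>d\<in>A. 1 - P d) \<le> (\<Sum>d\<in>A. P d)" for A
      using Weierstrass_prod_ineq[of A P] P by auto
    \<comment> \<open>The deficit of a single sample: the unit owed when \<open>c\<close> is hit,
      less the chord of \<open>c'\<close> if present. It is positive on samples without
      \<open>c'\<close> when \<open>P c > 0\<close> and becomes non-positive only in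
      expectation.\<close>
    define h where "h A = (if t \<in> good \<and> c \<in> A then P c * (1 - K * G c' * indicator {A. c' \<in> A} A) else 0)"
      for A :: "(nat \<times> nat) set"
    have sample: "k * (1 - (\<Prod>d\<in>A. 1 - P d)) \<le> (\<Sum>d\<in>A. K * G d + exp k * (\<omega> d * B d)) + h A"
      if A: "A \<in> set_pmf X" for A
    proof (cases "t \<in> good \<and> c \<in> A")
      case False
      have "k * (1 - (\<Prod>d\<in>A. 1 - P d)) \<le> (\<Sum>d\<in>A. k * P d)"
        using mult_left_mono[OF union[of A] k] by (simp add: sum_distrib_left)
      also have "\<dots> \<le> (\<Sum>d\<in>A. K * G d + exp k * (\<omega> d * B d))"
        using IH[of k] False by (intro sum_mono) (auto simp: \<omega>_def)
      finally show ?thesis using False by (auto simp: h_def)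
    next
      case True
      define R where "R = A - {c}"
      have R: "finite R" "c \<notin> R" "A = insert c R"
        using True finite_sample[OF A] by (auto simp: R_def)
      define \<Sigma> where "\<Sigma> = (\<Sum>d\<in>R. K * G d + exp k * B d)"
      have "k * (1 - (\<Prod>d\<in>R. 1 - P d)) \<le> (\<Sum>d\<in>R. k * P d)"
        using mult_left_mono[OF union[of R] k] by (simp add: sum_distrib_left)
      also have "\<dots> \<le> \<Sigma>"
        unfolding \<Sigma>_def by (intro sum_mono IH)
      finally have "(1 - P c) * (k * (1 - (\<Prod>d\<in>R. 1 - P d))) \<le> (1 - P c) * \<Sigma>"
        using P[of c] by (intro mult_left_mono) auto
      \<comment> \<open>Conditioning on \<open>c\<close>: with probability \<open>P c\<close> the
        whole \<open>k\<close> is charged at once, otherwise the exploration goes on in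
        \<open>R\<close>.\<close>
      moreover have "k * (1 - (\<Prod>d\<in>A. 1 - P d)) =
          (k - 1) * P c + P c + (1 - P c) * (k * (1 - (\<Prod>d\<in>R. 1 - P d)))"
        using R by (simp add: algebra_simps)
      moreover have "(k - 1) * P c \<le> K * G c + exp k * (\<omega> c * B c)"
        using IH[of "k - 1" c] True by (simp add: \<omega>_def exp_diff exp_minus field_simps)
      moreover have "K * G c' * indicator {A. c' \<in> A} A \<le> \<Sigma>"
      proof (cases "c' \<in> A")
        case True
        then have "c' \<in> R" using c by (simp add: R_def)
        then have "K * G c' + exp k * B c' \<le> \<Sigma>"
            unfolding \<Sigma>_def using R(1) K G B
            by (intro member_le_sum[of c' R "\<lambda>d. K * G d + exp k * B d"]) auto
          moreover have "0 \<le> exp k * B c'" using B by simp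
          ultimately have "K * G c' \<le> \<Sigma>" by linarith
          then show ?thesis using True by simp
      next
        case False
        then show ?thesis unfolding \<Sigma>_def using K G B by (auto intro!: sum_nonneg)
      qed
      then have "P c * (K * G c' * indicator {A. c' \<in> A} A) \<le> P c * \<Sigma>"
        using P by (intro mult_left_mono)
      moreover have "(\<Sum>d\<in>A. K * G d + exp k * (\<omega> d * B d)) = K * G c + exp k * (\<omega> c * B c) + \<Sigma>"
      proof -
        have "(\<Sum>d\<in>R. K * G d + exp k * (\<omega> d * B d)) = \<Sigma>"
          unfolding \<Sigma>_def using R(2) by (intro sum.cong) (auto simp: \<omega>_def)
        then show ?thesis using R by simp
      qed
      moreover have "h A = P c - P c * (K * G c' * indicator {A. c' \<in> A} A)"
        using True by (simp add: h_def algebra_simps)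
      ultimately show ?thesis by (simp add: algebra_simps)
    qed
    have h: "measure_pmf.expectation X h \<le> 0"
    proof (cases "t \<in> good")
      case False
      then have "h = (\<lambda>A. 0)" by (auto simp: h_def)
      then show ?thesis by simp
    next
      case True
      have "h = (\<lambda>A. P c * indicator {A. c \<in> A} A - P c * K * G c' * indicator {A. c \<in> A \<and> c' \<in> A} A)"
        using True by (auto simp: h_def indicator_def algebra_simps)
      then have "measure_pmf.expectation X h =
          P c / real L - P c * K * G c' * measure_pmf.prob X {A. c \<in> A \<and> c' \<in> A}"
        by (simp add: uniform[OF c(1)])
      moreover have "1 / real L \<le> K * G c' * measure_pmf.prob X {A. c \<in> A \<and> c' \<in> A}"
      proof -
        have "1 / real L = K * (1/8) * (1 / (4 * real L ^ 3))"
          using L_pos by (simp add: K_def power2_eq_square power3_eq_cube)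
        also have "\<dots> \<le> K * G c' * measure_pmf.prob X {A. c \<in> A \<and> c' \<in> A}"
          using K pair g[OF True] by (intro mult_mono mult_left_mono) (auto simp: G_def s_def)
        finally show ?thesis .
      qed
      then have "P c * (1 / real L) \<le> P c * (K * G c' * measure_pmf.prob X {A. c \<in> A \<and> c' \<in> A})"
        using P by (intro mult_left_mono)
      ultimately show ?thesis by (simp add: mult.assoc)
    qed
    have "k * p (Suc n) t = measure_pmf.expectation X (\<lambda>A. k * (1 - (\<Prod>d\<in>A. 1 - P d)))"
      by (simp add: P_def s_def)
    also have "\<dots> \<le> measure_pmf.expectation X (\<lambda>A. (\<Sum>d\<in>A. K * G d + exp k * (\<omega> d * B d)) + h A)"
      by (rule expectation_mono) (rule sample)
    also have "\<dots> = (\<Sum>d\<in>cells L. K * G d + exp k * (\<omega> d * B d)) / real L + measure_pmf.expectation X h"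
      by (simp add: expectation_sum)
    also have "\<dots> \<le> (\<Sum>d\<in>cells L. K * G d + exp k * (\<omega> d * B d)) / real L"
      using h by simp
    also have "\<dots> = K * ((\<Sum>d\<in>cells L. G d) / real L) + exp k * ((\<Sum>d\<in>cells L. \<omega> d * B d) / real L)"
      by (simp add: sum.distrib sum_distrib_left add_divide_distrib sum_divide_distrib)
    also have "(\<Sum>d\<in>cells L. G d) / real L = g t"
      using L_pos by (simp add: G_def s_def sum_g)
    also have "(\<Sum>d\<in>cells L. \<omega> d * B d) / real L = thinned c (Suc n) t"
    proof -
      have "(\<Sum>d\<in>cells L. \<omega> d * B d) =
          (\<Sum>d\<in>cells L. B d - (if d = c then (1 - exp (-1)) * (indicator good t * B c) else 0))"
        by (intro sum.cong) (auto simp: \<omega>_def indicator_def algebra_simps)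
      also have "\<dots> = (\<Sum>d\<in>cells L. B d) - (1 - exp (-1)) * (indicator good t * B c)"
        using c by (simp add: sum_subtractf)
      finally show ?thesis by (simp add: B_def s_def)
    qed
    finally show ?thesis by (simp only: K_def)
  qed
qed


lemma integrable_thinned: "integrable lborel (thinned c n)"
proof (induction n)
  case 0
  have "thinned c 0 = indicator {0..1 + \<sigma>}" by (rule ext) simp
  then show ?case by (auto intro!: integrable_real_indicator emeasure_bounded_finite)
next
  case (Suc n)
  have int: "integrable lborel (\<lambda>t. thinned c n (real L * t - a))" for a
    using Suc L_pos by (intro integrable_affine_shift) auto
  have "integrable lborel (\<lambda>t. indicator good t *\<^sub>R thinned c n (real L * t - off c))"
    by (rule integrable_mult_indicator) (auto simp: good_def int)
  with int show ?case
    by (auto intro!: integrable_divide_zero Bochner_Integration.integrable_diff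
        Bochner_Integration.integrable_sum integrable_mult_right)
qed

section \<open>Transport of mass into the good window\<close>

definition window_mass :: "nat \<times> nat \<Rightarrow> nat \<Rightarrow> real \<Rightarrow> real \<Rightarrow> real" where
  "window_mass c n a b = (LBINT t. indicator {a..b} t * thinned c n t)"

abbreviation mass :: "nat \<times> nat \<Rightarrow> nat \<Rightarrow> real" where
  "mass c n \<equiv> (LBINT t. thinned c n t)"

lemma integrable_window: "integrable lborel (\<lambda>t. indicator {a..b} t * thinned c n t)"
  using integrable_mult_indicator[OF _ integrable_thinned, of "{a..b}"] by simp

text \<open>Averaging preserves the integral as in \<open>integral_correction\<close>, so the only
  loss occurs at \<open>c\<close>. The window consists of the positions \<open>L t - off c\<close>
  for \<open>t\<close> in \<open>good\<close>; \<open>1 / L\<^sup>2\<close> combines the mean and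
  the change of variables.\<close>

lemma mass_Suc:
  "mass c (Suc n) = mass c n - (1 - exp (-1)) / real L ^ 2 *
     window_mass c n (real L - 1 + \<sigma> * (5/8) - off c) (real L - 1 + \<sigma> * (7/8) - off c)"
proof -
  let ?I = "{real L - 1 + \<sigma> * (5/8) - off c .. real L - 1 + \<sigma> * (7/8) - off c}"
  have "indicator good t = (indicator ?I (real L * t - off c) :: real)" for t
    using L_pos by (auto simp: good_def indicator_def pos_divide_le_eq pos_le_divide_eq mult.commute)
  then have good: "(\<lambda>t. indicator good t * thinned c n (real L * t - off c)) =
      (\<lambda>t. (\<lambda>s. indicator ?I s * thinned c n s) (real L * t - off c))"
    by simp
  have int: "integrable lborel (\<lambda>t. thinned c n (real L * t - a))" for a
    using integrable_thinned L_pos by (intro integrable_affine_shift) auto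
  have int_good: "integrable lborel (\<lambda>t. indicator good t * thinned c n (real L * t - off c))"
    unfolding good using L_pos by (intro integrable_affine_shift integrable_window) auto
  have good_mass: "(LBINT t. indicator good t * thinned c n (real L * t - off c)) =
      window_mass c n (real L - 1 + \<sigma> * (5/8) - off c) (real L - 1 + \<sigma> * (7/8) - off c) / real L"
    unfolding good window_mass_def using L_pos by (intro integral_affine_shift) simp
  have "mass c (Suc n) = ((\<Sum>d\<in>cells L. LBINT t. thinned c n (real L * t - off d)) -
     (1 - exp (-1)) * (LBINT t. indicator good t * thinned c n (real L * t - off c))) / real L"
    using int int_good by simp
  also have "\<dots> = (real L * mass c n - (1 - exp (-1)) * (window_mass c n
      (real L - 1 + \<sigma> * (5/8) - off c) (real L - 1 + \<sigma> * (7/8) - off c) / real L)) / real L"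
    unfolding good_mass using L_pos by (simp add: integral_affine_shift card_cells)
  finally show ?thesis
    using L_pos by (simp add: field_simps power2_eq_square)
qed

context
  fixes c :: "nat \<times> nat"
  assumes c: "c \<in> cells L"
begin

lemma mass_nonneg: "0 \<le> mass c n"
  using thinned_nonneg[OF c] by (intro Bochner_Integration.integral_nonneg)

lemma window_mass_nonneg: "0 \<le> window_mass c n a b"
  unfolding window_mass_def using thinned_nonneg[OF c] by (intro Bochner_Integration.integral_nonneg) simp

lemma mass_decreasing: "mass c (n + k) \<le> mass c n"
proof (induction k)
  case (Suc k)
  have "0 \<le> (1 - exp (-1)) / real L ^ 2 * window_mass c (n + k)
      (real L - 1 + \<sigma> * (5/8) - off c) (real L - 1 + \<sigma> * (7/8) - off c)"
    using window_mass_nonneg by (intro mult_nonneg_nonneg divide_nonneg_nonneg) auto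
  then show ?case using Suc mass_Suc[of c "n + k"] by simp
qed simp

lemma mass_0_le: "mass c 0 \<le> 2"
  using sigma_pos sigma_le_1 by simp

text \<open>Follows a single descendant, whose leading base-\<open>L\<close> digits name the first
  child; the others are dropped, and thinning costs at most \<open>exp (-1)\<close> per
  level.\<close>

lemma thinned_cell_ge:
  "a < L ^ m \<Longrightarrow> j < L ^ m \<Longrightarrow>
    exp (- real m) / real L ^ m * thinned c n (real L ^ m * t - (real a + \<sigma> * real j)) \<le> thinned c (n + m) t"
proof (induction m arbitrary: t a j)
  case (Suc m)
  define N where "N = L ^ m"
  have N: "N > 0" using L_pos by (simp add: N_def)
  define d where "d = (a div N, j div N)"
  have d: "d \<in> cells L"
    using Suc.prems N by (auto simp: d_def cells_def N_def[symmetric] less_mult_imp_div_less)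
  have a: "real a = real N * real (fst d) + real (a mod N)" "real j = real N * real (snd d) + real (j mod N)"
    unfolding d_def by (simp_all only: fst_conv snd_conv of_nat_mult[symmetric] of_nat_add[symmetric] mult_div_mod_eq)
  have arg: "real L ^ m * (real L * t - off d) - (real (a mod N) + \<sigma> * real (j mod N)) =
      real L ^ Suc m * t - (real a + \<sigma> * real j)"
    unfolding a off_eq by (simp add: N_def algebra_simps)
  have "exp (- real (Suc m)) / real L ^ Suc m * thinned c n (real L ^ Suc m * t - (real a + \<sigma> * real j)) =
     exp (-1) * ((exp (- real m) / real L ^ m *
       thinned c n (real L ^ m * (real L * t - off d) - (real (a mod N) + \<sigma> * real (j mod N)))) / real L)"
  proof -
    have "exp (- real (Suc m)) = exp (-1) * exp (- real m)"
      by (simp add: exp_add[symmetric])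
    then show ?thesis unfolding arg by (simp add: mult_ac)
  qed
  also have "\<dots> \<le> exp (-1) * (thinned c (n + m) (real L * t - off d) / real L)"
    using N by (intro mult_left_mono divide_right_mono Suc.IH) (auto simp: N_def)
  also have "\<dots> \<le> thinned c (n + Suc m) t"
    using thinned_step_ge(2)[OF c thinned_nonneg[OF c], of "{d}" "n + m" t] d by simp
  finally show ?case .
qed simp

text \<open>The last column of the level-\<open>m\<close> grid is reached through last-column
  children only, none of which is \<open>c\<close>; hence no factor \<open>exp (- m)\<close>
  appears.\<close>

lemma thinned_column_ge:
  assumes "fst c \<noteq> L - 1"
  shows "(\<Sum>j<L ^ m. thinned c n (real L ^ m * t - (real L ^ m - 1) - \<sigma> * real j)) / real L ^ m
    \<le> thinned c (n + m) t"
proof (induction m arbitrary: t)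
  case (Suc m)
  define N where "N = L ^ m"
  define F where "F k = thinned c n (real L ^ Suc m * t - (real L ^ Suc m - 1) - \<sigma> * real k)" for k
  let ?J = "(\<lambda>j. (L - 1, j)) ` {..<L}"
  have J: "?J \<subseteq> cells L" "c \<notin> ?J" using assms L_ge_2 by (auto simp: cells_def)
  have offJ: "off (L - 1, j) = real L - 1 + \<sigma> * real j" for j
    using L_pos by (simp add: off_eq of_nat_diff)
  have arg: "real L ^ m * (real L * t - off (L - 1, j)) - (real L ^ m - 1) - \<sigma> * real i =
      real L ^ Suc m * t - (real L ^ Suc m - 1) - \<sigma> * real (j * N + i)" for i j
    unfolding offJ by (simp add: N_def algebra_simps)
  have block: "sum F {j * N..<j * N + N} = (\<Sum>i<N. F (j * N + i))" for j
    using sum.shift_bounds_nat_ivl[of F 0 "j * N" N] by (simp add: lessThan_atLeast0 add.commute)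
  have "(\<Sum>k<L ^ Suc m. F k) / real L ^ Suc m = (\<Sum>j<L. (\<Sum>i<N. F (j * N + i)) / real L ^ m) / real L"
  proof -
    have "(\<Sum>k<L ^ Suc m. F k) = (\<Sum>j<L. \<Sum>i<N. F (j * N + i))"
      unfolding block[symmetric] using sum.nat_group[of F N L] by (simp add: N_def)
    then show ?thesis
      by (simp add: sum_divide_distrib[symmetric] mult.commute)
  qed
  also have "\<dots> \<le> (\<Sum>j<L. thinned c (n + m) (real L * t - off (L - 1, j))) / real L"
    using Suc.IH[of "real L * t - off (L - 1, _)", unfolded arg]
    by (intro divide_right_mono sum_mono) (auto simp only: F_def N_def of_nat_0_le_iff)
  also have "\<dots> = (\<Sum>d\<in>?J. thinned c (n + m) (real L * t - off d)) / real L"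
    by (subst sum.reindex) (auto simp: inj_on_def)
  also have "\<dots> \<le> thinned c (n + Suc m) t"
    using thinned_step_ge(1)[OF c thinned_nonneg[OF c] J, of "n + m" t] by simp
  finally show ?case by (simp only: F_def)
qed simp

text \<open>A window of length \<open>3 / L ^ m\<close> contains the shadow of some
  level-\<open>m\<close> cell: along the bottom row and then up the last column the offsets
  \<open>i + \<sigma> j\<close> advance in steps of at most 1, and in these units a shadow has
  length at most 2.\<close>

lemma window_mass_ge:
  assumes w: "0 \<le> a" "b \<le> 1 + \<sigma>" and long: "3 \<le> real L ^ m * (b - a)"
  shows "exp (- real m) / real L ^ (2 * m) * mass c n \<le> window_mass c (n + m) a b"
proof -
  define N where "N = real L ^ m"
  have N: "N \<ge> 1" "N > 0" using L_pos by (simp_all add: N_def)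
  have Nb: "N * a + 3 \<le> N * b" "N * b \<le> N + N * \<sigma>"
    using long w N mult_left_mono[of b "1 + \<sigma>" N] by (simp_all add: N_def algebra_simps)
  have "\<exists>i j. i < L ^ m \<and> j < L ^ m \<and> N * a \<le> real i + \<sigma> * real j \<and>
      real i + \<sigma> * real j + (1 + \<sigma>) \<le> N * b"
  proof (cases "N * a \<le> N - 1")
    case True
    define i where "i = nat \<lceil>N * a\<rceil>"
    have "0 \<le> N * a" using N w by simp
    then have i: "N * a \<le> real i" "real i < N * a + 1" unfolding i_def by linarith+
    then have "real i < real (L ^ m)"
      unfolding of_nat_power N_def[symmetric] using True by linarith
    then have "i < L ^ m" by (simp only: of_nat_less_iff)
    then show ?thesis
      using i Nb sigma_le_1 L_pos by (intro exI[of _ i] exI[of _ 0]) simp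
  next
    case False
    define x where "x = (N * a - (N - 1)) / \<sigma>"
    define j where "j = nat \<lceil>x\<rceil>"
    have x: "0 \<le> x" "\<sigma> * x = N * a - (N - 1)" using False sigma_pos by (simp_all add: x_def)
    then have j: "x \<le> real j" "real j < x + 1" unfolding j_def by linarith+
    have j': "\<sigma> * x \<le> \<sigma> * real j" "\<sigma> * real j \<le> \<sigma> * x + \<sigma>"
      using mult_left_mono[of "real j" "x + 1" \<sigma>] mult_left_mono[of x "real j" \<sigma>] j sigma_pos
      by (simp_all add: algebra_simps)
    have "\<sigma> * real j < \<sigma> * N"
      using j' x Nb sigma_le_1 by (simp add: mult.commute)
    then have "real j < real (L ^ m)" using sigma_pos by (simp add: N_def)
    then have "j < L ^ m" by (simp only: of_nat_less_iff)
    moreover have "real (L ^ m - 1) = N - 1" using L_pos by (simp add: N_def of_nat_diff)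
    ultimately show ?thesis
      using j' x Nb sigma_le_1 L_pos by (intro exI[of _ "L ^ m - 1"] exI[of _ j]) simp
  qed
  then obtain i j where ij: "i < L ^ m" "j < L ^ m" "N * a \<le> real i + \<sigma> * real j"
      "real i + \<sigma> * real j + (1 + \<sigma>) \<le> N * b" by blast
  define r where "r = real i + \<sigma> * real j"
  define \<gamma> where "\<gamma> = exp (- real m) / N"
  have "exp (- real m) / real L ^ (2 * m) * mass c n = \<gamma> * (mass c n / N)"
    by (simp add: \<gamma>_def N_def power_mult[symmetric] power2_eq_square mult_2 power_add)
  also have "\<dots> = (LBINT t. \<gamma> * thinned c n (N * t - r))"
    using integral_affine_shift[OF N(2), of "thinned c n" r] by simp
  also have "\<dots> \<le> window_mass c (n + m) a b"
    unfolding window_mass_def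
  proof (rule integral_mono)
    show "integrable lborel (\<lambda>t. \<gamma> * thinned c n (N * t - r))"
      by (intro integrable_mult_right integrable_affine_shift integrable_thinned N)
    show "integrable lborel (\<lambda>t. indicator {a..b} t * thinned c (n + m) t)"
      by (rule integrable_window)
    fix t
    show "\<gamma> * thinned c n (N * t - r) \<le> indicator {a..b} t * thinned c (n + m) t"
    proof (cases "N * t - r \<in> {0..1 + \<sigma>}")
      case True
      then have "N * a \<le> N * t" "N * t \<le> N * b" using ij by (auto simp: r_def)
      then have "t \<in> {a..b}" using N by simp
      then show ?thesis
        using thinned_cell_ge[OF ij(1,2), of n t] by (simp add: \<gamma>_def N_def r_def)
    next
      case False
      then show ?thesis
        using thinned_eq_0[OF c False] thinned_nonneg[OF c] by simp
    qed
  qed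
  finally show ?thesis .
qed

text \<open>The target window has length only \<open>\<sigma> / 4\<close>, but the last column at
  depth \<open>m\<close> magnifies positions by \<open>q\<close>. For
  \<open>11/16 \<le> i / q \<le> 14/16\<close>, cell \<open>i\<close> maps the source window, of
  length \<open>\<sigma> q / 16\<close>, back into the target, since 11/16 - 1/16 = 5/8 and 14/16 =
  7/8. The source has length of order 1 once \<open>q\<close> is of order
  \<open>1 / \<sigma>\<close>.\<close>

lemma column_window_mass_ge:
  fixes m q :: nat and h :: real
  defines "q \<equiv> L ^ m"
  assumes last: "fst c \<noteq> L - 1" and q: "q \<ge> 16"
  shows "1 / (16 * real q) * window_mass c n (1 - \<sigma> * (h * q + q / 16)) (1 - \<sigma> * (h * q))
    \<le> window_mass c (n + m) (1 + \<sigma> * (5/8 - h)) (1 + \<sigma> * (7/8 - h))"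
proof -
  define W where "W = window_mass c n (1 - \<sigma> * (h * q + q / 16)) (1 - \<sigma> * (h * q))"
  define T where "T = {1 + \<sigma> * (5/8 - h) .. 1 + \<sigma> * (7/8 - h)}"
  define V where "V = {1 - \<sigma> * (h * q + q / 16) .. 1 - \<sigma> * (h * q)}"
  \<comment> \<open>Starts at \<open>11 q / 16\<close> rounded up; the \<open>q div 8\<close>
    indices number at least \<open>q / 16\<close>, as \<open>q \<ge> 16\<close>.\<close>
  define I where "I = {(11 * q + 15) div 16 ..< (11 * q + 15) div 16 + q div 8}"
  define f where "f s = indicator V s * thinned c n s" for s
  have q0: "real q > 0" using q by simp
  have I: "11 * real q \<le> 16 * real i" "16 * real i \<le> 14 * real q" "i < q" if "i \<in> I" for i
  proof -
    have "11 * q \<le> 16 * i" "16 * i \<le> 14 * q" using that by (auto simp: I_def)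
    then show "11 * real q \<le> 16 * real i" "16 * real i \<le> 14 * real q" by linarith+
    with q0 show "i < q" by linarith
  qed
  have card_I: "real q / 16 \<le> real (card I)"
    using q by (simp add: I_def)
  have point: "(\<Sum>i\<in>I. f (real q * t - (real q - 1 + \<sigma> * real i))) / real q \<le> indicator T t * thinned c (n + m) t" for t
  proof -
    have "f (real q * t - (real q - 1 + \<sigma> * real i)) \<le> indicator T t * thinned c n (real q * t - (real q - 1) - \<sigma> * real i)"
      if i: "i \<in> I" for i
    proof (cases "real q * t - (real q - 1 + \<sigma> * real i) \<in> V")
      case True
      have i': "\<sigma> * (11 * real q) \<le> \<sigma> * (16 * real i)" "\<sigma> * (16 * real i) \<le> \<sigma> * (14 * real q)"
        using I[OF i] sigma_pos by (simp_all only: mult_le_cancel_left_pos)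
      have "real q * (1 + \<sigma> * (5/8 - h)) \<le> real q * t"
        using True i' by (simp add: V_def algebra_simps)
      moreover have "real q * t \<le> real q * (1 + \<sigma> * (7/8 - h))"
        using True i' by (simp add: V_def algebra_simps)
      ultimately have "t \<in> T" using q0 by (simp add: T_def)
      then show ?thesis using True by (simp add: f_def diff_diff_eq)
    qed (simp add: f_def thinned_nonneg[OF c])
    then have "(\<Sum>i\<in>I. f (real q * t - (real q - 1 + \<sigma> * real i))) \<le>
       (\<Sum>i\<in>I. indicator T t * thinned c n (real q * t - (real q - 1) - \<sigma> * real i))"
      by (rule sum_mono)
    also have "\<dots> \<le> (\<Sum>i<q. indicator T t * thinned c n (real q * t - (real q - 1) - \<sigma> * real i))"
      using I(3) thinned_nonneg[OF c] by (intro sum_mono2) auto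
    also have "\<dots> / real q = indicator T t * ((\<Sum>i<q. thinned c n (real q * t - (real q - 1) - \<sigma> * real i)) / real q)"
      by (simp add: sum_distrib_left)
    also have "\<dots> \<le> indicator T t * thinned c (n + m) t"
      using thinned_column_ge[OF last, of n m t] by (intro mult_left_mono) (auto simp: q_def)
    finally show ?thesis using q0 by (simp add: divide_right_mono)
  qed
  have int_f: "integrable lborel f"
    unfolding f_def V_def by (rule integrable_window)
  have W: "W = (LBINT s. f s)" by (simp add: W_def window_mass_def f_def V_def)
  have int_fi: "integrable lborel (\<lambda>t. f (real q * t - a))" for a
    by (rule integrable_affine_shift[OF q0 int_f])
  have "1 / (16 * real q) * W = (real q / 16) * (W / real q) / real q"
    using q0 by simp
  also have "\<dots> \<le> real (card I) * (W / real q) / real q"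
    using card_I q0 window_mass_nonneg by (intro divide_right_mono mult_right_mono) (auto simp: W_def)
  also have "\<dots> = (LBINT t. (\<Sum>i\<in>I. f (real q * t - (real q - 1 + \<sigma> * real i))) / real q)"
    using int_fi q0 by (simp add: integral_affine_shift W)
  also have "\<dots> \<le> (LBINT t. indicator T t * thinned c (n + m) t)"
    using int_fi point integrable_window unfolding T_def
    by (intro integral_mono) (auto intro!: integrable_divide_zero Bochner_Integration.integrable_sum)
  finally show ?thesis by (simp add: W_def window_mass_def T_def)
qed

end
end

text \<open>The depth is chosen so that every interval of length \<open>1 / (64 L\<^sup>2)\<close> inside the shadow of the unit
  square contains the shadow of a square of that level.\<close>

definition cell_depth :: "nat \<Rightarrow> nat" where
  "cell_depth L = 192 * L\<^sup>2"

definition cell_weight :: "nat \<Rightarrow> real" where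
  "cell_weight L = exp (- real (cell_depth L)) / real L ^ (2 * cell_depth L)"

text \<open>The loss factor of \<open>mass_Suc\<close> times the share of mass found in
  \<open>target_mass\<close>, with \<open>\<sigma>\<close> taken out.\<close>

definition decay_rate :: "nat \<Rightarrow> real" where
  "decay_rate L = (1 - exp (-1)) / real L ^ 2 * (cell_weight L / 16)"

text \<open>The trivial bound 2 on the integral, plus \<open>2 / \<delta>\<close> times the bound on
  \<open>k * u\<close> obtained in \<open>integral_hit_prob_le\<close>.\<close>

definition upper_const :: "nat \<Rightarrow> real" where
  "upper_const L = 2 + 2 / decay_rate L * (64 * real L ^ 2 + 2 * exp (decay_rate L * (1 + real (cell_depth L))))"

context steep_lines
begin

lemma cell_weight_pos: "0 < cell_weight L"
  using L_pos by (simp add: cell_weight_def)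

lemma decay_rate_pos: "0 < decay_rate L"
  using L_pos cell_weight_pos by (simp add: decay_rate_def)

lemma power_cell_depth_ge: "192 * real L ^ 2 \<le> real L ^ cell_depth L"
proof -
  have "cell_depth L < 2 ^ cell_depth L" by (rule less_exp)
  also have "\<dots> \<le> L ^ cell_depth L" using L_ge_2 by (rule power_mono) simp
  finally have "real (cell_depth L) \<le> real (L ^ cell_depth L)" by simp
  then show ?thesis by (simp add: cell_depth_def)
qed

text \<open>For \<open>\<sigma> > 1 / (16 L\<^sup>2)\<close> the window is long enough to contain a
  whole cell shadow at depth \<open>cell_depth L\<close>. For smaller \<open>\<sigma>\<close> the
  last column first magnifies it by a power \<open>q\<close> of \<open>L\<close> comparable to
  \<open>1 / \<sigma>\<close>; the factor \<open>1 / q\<close> lost there is the expected share of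
  order \<open>\<sigma>\<close>.\<close>

lemma target_mass:
  assumes c: "c \<in> chain" "fst c \<noteq> L - 1"
  obtains N where "\<sigma> * real N \<le> 1 + real (cell_depth L)"
    "\<And>n. \<sigma> * (cell_weight L / 16) * mass c n \<le> window_mass c (n + N)
      (real L - 1 + \<sigma> * (5/8) - off c) (real L - 1 + \<sigma> * (7/8) - off c)"
proof -
  define m1 where "m1 = cell_depth L"
  define lo hi where "lo = real L - 1 + \<sigma> * (5/8) - off c" and "hi = real L - 1 + \<sigma> * (7/8) - off c"
  have cL: "c \<in> cells L" using c chain_subset by blast
  have "g lo \<ge> 1/8" "g hi \<ge> 1/8"
    unfolding lo_def hi_def by (rule g_chain[OF c(1)]; simp)+
  moreover have "x \<in> {0..1 + \<sigma>}" if "g x \<ge> 1/8" for x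
    using g_bounds(2)[of x] that by (cases "x \<in> {0..1 + \<sigma>}") auto
  ultimately have "lo \<in> {0..1 + \<sigma>}" "hi \<in> {0..1 + \<sigma>}"
    by blast+
  then have lohi: "0 \<le> lo" "hi \<le> 1 + \<sigma>" by auto
  have mass0: "0 \<le> mass c n" for n by (rule mass_nonneg[OF cL])
  show ?thesis
  proof (cases "1 < \<sigma> * (16 * real L ^ 2)")
    case True
    have "3 \<le> 192 * real L ^ 2 * (\<sigma> / 4)" using True by (simp add: mult.commute)
    also have "\<dots> \<le> real L ^ m1 * (hi - lo)"
      using power_cell_depth_ge sigma_pos unfolding m1_def
      by (intro mult_mono) (auto simp: lo_def hi_def)
    finally have long: "3 \<le> real L ^ m1 * (hi - lo)" .
    have "\<sigma> * (cell_weight L / 16) * mass c n \<le> window_mass c (n + m1) lo hi" for n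
    proof -
      have "\<sigma> * (cell_weight L / 16) \<le> 1 * cell_weight L"
        using sigma_le_1 sigma_pos cell_weight_pos by (intro mult_mono) auto
      then have "\<sigma> * (cell_weight L / 16) * mass c n \<le> cell_weight L * mass c n"
        using mass0 by (intro mult_right_mono) auto
      also have "\<dots> \<le> window_mass c (n + m1) lo hi"
        using window_mass_ge[OF cL lohi long, of n] by (simp add: cell_weight_def m1_def)
      finally show ?thesis .
    qed
    moreover have "\<sigma> * real m1 \<le> 1 * real m1" using sigma_le_1 by (intro mult_right_mono) auto
    ultimately show ?thesis
      using that[of m1] by (simp add: m1_def lo_def hi_def)
  next
    case False
    then have small: "\<sigma> * (16 * real L ^ 2) \<le> 1" by simp
    \<comment> \<open>Backing off two levels from the first power of \<open>L\<close> above
      \<open>1 / \<sigma>\<close> gives \<open>\<sigma> q L \<le> 1\<close>, which keeps the source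
      window inside the shadow, while \<open>\<sigma> q\<close> stays above
      \<open>1 / L\<^sup>2\<close>.\<close>
    define k where "k = (LEAST k. 1 < \<sigma> * real L ^ k)"
    have "\<exists>k. 1 < \<sigma> * real L ^ k"
    proof -
      obtain k where "1 / \<sigma> < real L ^ k"
        using real_arch_pow[of "real L" "1 / \<sigma>"] L_real by auto
      then show ?thesis using sigma_pos by (auto simp: pos_divide_less_eq mult.commute)
    qed
    then have k: "1 < \<sigma> * real L ^ k" unfolding k_def by (rule LeastI_ex)
    have k_least: "\<sigma> * real L ^ j \<le> 1" if "j < k" for j
      using not_less_Least[of j "\<lambda>k. 1 < \<sigma> * real L ^ k"] that by (simp add: k_def not_less)
    have "k \<noteq> 0" using k sigma_le_1 by (intro notI) simp
    moreover have "k \<noteq> 1"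
    proof
      assume "k = 1"
      then have "1 < \<sigma> * real L" using k by simp
      moreover have "\<sigma> * real L \<le> \<sigma> * (16 * real L ^ 2)"
        using sigma_pos L_real by (simp add: power2_eq_square)
      ultimately show False using small by simp
    qed
    ultimately obtain m where m: "k = Suc (Suc m)"
      by (metis One_nat_def not0_implies_Suc)
    define q where "q = L ^ m"
    have q: "1 < \<sigma> * real q * real L ^ 2" "\<sigma> * real q * real L \<le> 1"
      using k k_least[of "Suc m"] by (simp_all add: m q_def power2_eq_square mult_ac)
    have q0: "0 < real q" using L_pos by (simp add: q_def)
    have "\<sigma> * real L ^ 2 * 16 < \<sigma> * real L ^ 2 * real q"
      using q(1) small by (simp add: mult_ac)
    then have "16 < real q"
      using sigma_pos L_pos by simp
    then have q16: "16 \<le> L ^ m" unfolding q_def by linarith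
    have q1: "\<sigma> * real q \<le> 1"
    proof -
      have "\<sigma> * real q * 1 \<le> \<sigma> * real q * real L"
        using L_real sigma_pos q0 by (intro mult_left_mono) auto
      then show ?thesis using q(2) by simp
    qed
    define h where "h = real (snd c)"
    have h: "0 \<le> h" "h + 1 \<le> real L" using cL by (auto simp: h_def cells_def)
    have "fst c < L - 1"
      using cL c by (auto simp: cells_def)
    \<comment> \<open>For such small \<open>\<sigma>\<close> the line drifts by less than one column
      over all \<open>L\<close> rows, so a chain square outside the last column lies in column
      \<open>L - 2\<close>.\<close>
    have "real (fst c) > real L - 3"
    proof -
      have "\<sigma> * real L \<le> \<sigma> * (16 * real L ^ 2)"
        using sigma_pos L_real by (simp add: power2_eq_square)
      moreover have "\<sigma> * (h + 1) \<le> \<sigma> * real L"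
        using h sigma_pos by (intro mult_left_mono) auto
      ultimately have "\<sigma> * (h + 1) \<le> 1" using small by linarith
      then have "\<sigma> * h + \<sigma> \<le> 1" by (simp add: distrib_left)
      then show ?thesis
        using lohi(2) sigma_pos by (simp add: hi_def off_eq h_def)
    qed
    then have "real L < real (fst c + 3)" by simp
    then have "L < fst c + 3" by (simp only: of_nat_less_iff)
    with \<open>fst c < L - 1\<close> have "fst c + 2 = L" by linarith
    then have col: "real (fst c) = real L - 2" by linarith
    have lo: "lo = 1 + \<sigma> * (5/8 - h)" and hi: "hi = 1 + \<sigma> * (7/8 - h)"
      by (simp_all add: lo_def hi_def off_eq col h_def algebra_simps)
    define a b where "a = 1 - \<sigma> * (h * real q + real q / 16)" and "b = 1 - \<sigma> * (h * real q)"
    have "\<sigma> * real q * (h + 1 / 16) \<le> \<sigma> * real q * real L"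
      using h sigma_pos q0 by (intro mult_left_mono) auto
    then have a: "0 \<le> a" using q(2) by (simp add: a_def algebra_simps)
    have "0 \<le> \<sigma> * (h * real q)" using h q0 sigma_pos by simp
    then have b: "b \<le> 1 + \<sigma>" using sigma_pos unfolding b_def by linarith
    have "3 \<le> 12 * (\<sigma> * real q * real L ^ 2)" using q(1) by simp
    also have "\<dots> = 192 * real L ^ 2 * (\<sigma> * real q / 16)" by simp
    also have "\<dots> \<le> real L ^ m1 * (\<sigma> * real q / 16)"
      using power_cell_depth_ge sigma_pos q0 unfolding m1_def by (intro mult_right_mono) auto
    also have "\<sigma> * real q / 16 = b - a" by (simp add: a_def b_def algebra_simps)
    finally have long: "3 \<le> real L ^ m1 * (b - a)" .
    have "\<sigma> * (cell_weight L / 16) * mass c n \<le> window_mass c (n + (m1 + m)) lo hi" for n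
    proof -
      have "\<sigma> \<le> 1 / real q" using q1 q0 by (simp add: pos_le_divide_eq)
      then have "\<sigma> * (cell_weight L / 16 * mass c n) \<le> 1 / real q * (cell_weight L / 16 * mass c n)"
        using mass0 cell_weight_pos by (intro mult_right_mono) auto
      also have "\<dots> = 1 / (16 * real q) * (cell_weight L * mass c n)" by simp
      also have "\<dots> \<le> 1 / (16 * real q) * window_mass c (n + m1) a b"
        using window_mass_ge[OF cL a b long, of n] q0
        by (intro mult_left_mono) (auto simp: cell_weight_def m1_def)
      also have "\<dots> \<le> window_mass c (n + m1 + m) lo hi"
        using column_window_mass_ge[OF cL c(2) q16, of "n + m1" h]
        by (simp add: a_def b_def lo hi q_def)
      finally show ?thesis by (simp add: add.assoc mult.assoc)
    qed
    moreover have "\<sigma> * real (m1 + m) \<le> 1 + real m1"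
    proof -
      have "m < 2 ^ m" by (rule less_exp)
      also have "\<dots> \<le> L ^ m" using L_ge_2 by (rule power_mono) simp
      finally have "real m \<le> real q" by (simp add: q_def)
      then have "\<sigma> * real m \<le> \<sigma> * real q" using sigma_pos by (intro mult_left_mono) auto
      then have "\<sigma> * real m \<le> 1" using q1 by linarith
      moreover have "\<sigma> * real m1 \<le> 1 * real m1" using sigma_le_1 by (intro mult_right_mono) auto
      ultimately show ?thesis by (simp add: algebra_simps)
    qed
    ultimately show ?thesis
      using that[of "m1 + m"] by (simp only: m1_def lo_def hi_def)
  qed
qed

text \<open>The loss at level \<open>k + N\<close> is controlled by the mass at level
  \<open>k\<close>, which is at least the mass at \<open>k + N\<close>; so every level gains a
  factor \<open>1 - \<delta> \<sigma>\<close>. Starting only at level \<open>N\<close> costs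
  \<open>exp (\<delta> \<sigma> N)\<close>, which is bounded because \<open>\<sigma> N\<close>
  is.\<close>

lemma mass_decay:
  assumes c: "c \<in> chain" "fst c \<noteq> L - 1"
  shows "mass c n \<le> 2 * exp (decay_rate L * (1 + real (cell_depth L))) * exp (- (decay_rate L * \<sigma> * real n))"
proof -
  define \<delta> where "\<delta> = decay_rate L"
  have \<delta>: "0 < \<delta>" using decay_rate_pos by (simp add: \<delta>_def)
  have cL: "c \<in> cells L" using c chain_subset by blast
  obtain N where N: "\<sigma> * real N \<le> 1 + real (cell_depth L)"
    "\<And>n. \<sigma> * (cell_weight L / 16) * mass c n \<le> window_mass c (n + N)
      (real L - 1 + \<sigma> * (5/8) - off c) (real L - 1 + \<sigma> * (7/8) - off c)"
    using target_mass[OF c] by blast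
  have step: "mass c (Suc (k + N)) \<le> exp (- (\<delta> * \<sigma>)) * mass c (k + N)" for k
  proof -
    have "\<delta> * \<sigma> * mass c (k + N) \<le> \<delta> * \<sigma> * mass c k"
      using mass_decreasing[OF cL, of k N] \<delta> sigma_pos by (intro mult_left_mono) auto
    also have "\<dots> = (1 - exp (-1)) / real L ^ 2 * (\<sigma> * (cell_weight L / 16) * mass c k)"
      by (simp add: \<delta>_def decay_rate_def)
    also have "\<dots> \<le> (1 - exp (-1)) / real L ^ 2 * window_mass c (k + N)
      (real L - 1 + \<sigma> * (5/8) - off c) (real L - 1 + \<sigma> * (7/8) - off c)"
      using N(2)[of k] by (intro mult_left_mono) auto
    finally have "mass c (Suc (k + N)) \<le> (1 - \<delta> * \<sigma>) * mass c (k + N)"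
      using mass_Suc[of c "k + N"] by (simp add: algebra_simps)
    also have "\<dots> \<le> exp (- (\<delta> * \<sigma>)) * mass c (k + N)"
      using exp_ge_add_one_self[of "- (\<delta> * \<sigma>)"] mass_nonneg[OF cL] by (intro mult_right_mono) auto
    finally show ?thesis .
  qed
  have le_2: "mass c n \<le> 2" for n
    using mass_decreasing[OF cL, of 0 n] mass_0_le[OF cL] by simp
  have decay: "mass c (k + N) \<le> 2 * exp (- (\<delta> * \<sigma> * real k))" for k
  proof (induction k)
    case 0
    then show ?case using le_2 by simp
  next
    case (Suc k)
    have "mass c (Suc k + N) \<le> exp (- (\<delta> * \<sigma>)) * (2 * exp (- (\<delta> * \<sigma> * real k)))"
      unfolding add_Suc by (rule order_trans[OF step mult_left_mono[OF Suc]]) simp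
    also have "\<dots> = 2 * exp (- (\<delta> * \<sigma> * real (Suc k)))"
      by (simp add: exp_add[symmetric] algebra_simps)
    finally show ?case .
  qed
  have \<delta>N: "\<delta> * (\<sigma> * real N) \<le> \<delta> * (1 + real (cell_depth L))"
    using N(1) \<delta> by (intro mult_left_mono) auto
  have "mass c n \<le> 2 * exp (\<delta> * (1 + real (cell_depth L)) - \<delta> * \<sigma> * real n)"
  proof (cases "N \<le> n")
    case True
    then have "mass c n \<le> 2 * exp (- (\<delta> * \<sigma> * real (n - N)))" using decay[of "n - N"] by simp
    also have "\<dots> \<le> 2 * exp (\<delta> * (1 + real (cell_depth L)) - \<delta> * \<sigma> * real n)"
      using \<delta>N True by (simp add: of_nat_diff algebra_simps)
    finally show ?thesis .
  next
    case False
    then have "\<delta> * (\<sigma> * real n) \<le> \<delta> * (\<sigma> * real N)"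
      using \<delta> sigma_pos by (intro mult_left_mono) auto
    then have "0 \<le> \<delta> * (1 + real (cell_depth L)) - \<delta> * \<sigma> * real n"
      using \<delta>N by (simp add: mult.assoc)
    then have "1 \<le> exp (\<delta> * (1 + real (cell_depth L)) - \<delta> * \<sigma> * real n)"
      by (simp only: one_le_exp_iff)
    then show ?thesis using le_2[of n] by linarith
  qed
  then show ?thesis by (simp add: \<delta>_def exp_diff exp_minus field_simps)
qed

lemma integral_hit_prob_le: "(LBINT t. p n t) \<le> upper_const L / (1 + \<sigma> * real n)"
proof -
  define u where "u = (LBINT t. p n t)"
  define \<delta> where "\<delta> = decay_rate L"
  define M where "M = exp (\<delta> * (1 + real (cell_depth L)))"
  have \<delta>: "0 < \<delta>" using decay_rate_pos by (simp add: \<delta>_def)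
  obtain c c' where c: "c \<in> chain" "c' \<in> chain" "c \<noteq> c'" "fst c \<noteq> L - 1"
    "1 / (4 * real L ^ 3) \<le> measure_pmf.prob X {A. c \<in> A \<and> c' \<in> A}"
    using exists_chain_pair by blast
  have g_good: "g (real L * t - off c') \<ge> 1/8" if "t \<in> good" for t
    using that g_chain[OF c(2)] by (auto elim!: goodE)
  \<comment> \<open>Half the decay exponent: \<open>exp k\<close> times the decayed mass is at most
    a constant times \<open>exp (- k)\<close>, while \<open>k\<close> itself is still proportional
    to \<open>\<sigma> n\<close>.\<close>
  define k where "k = \<delta> * \<sigma> * real n / 2"
  have k: "0 \<le> k" using \<delta> sigma_pos by (simp add: k_def)
  have "k * u = (LBINT t. k * p n t)"
    by (simp add: u_def)
  also have "\<dots> \<le> (LBINT t. 32 * real L ^ 2 * g t + exp k * thinned c n t)"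
    using integrable_p integrable_g integrable_thinned c chain_subset g_good
    by (intro integral_mono hit_prob_le) auto
  also have "\<dots> = 32 * real L ^ 2 * (LBINT t. g t) + exp k * mass c n"
    using integrable_g integrable_thinned by simp
  also have "\<dots> \<le> 32 * real L ^ 2 * 2 + exp k * (2 * M * exp (- (\<delta> * \<sigma> * real n)))"
    using integral_g_le_2 mass_decay[OF c(1,4), of n]
    by (intro add_mono mult_left_mono) (auto simp: \<delta>_def M_def)
  also have "exp k * (2 * M * exp (- (\<delta> * \<sigma> * real n))) = 2 * M * exp (- k)"
  proof -
    have "exp k * exp (- (\<delta> * \<sigma> * real n)) = exp (- k)"
      by (simp add: exp_add[symmetric] k_def)
    then show ?thesis by (simp add: mult_ac)
  qed
  also have "\<dots> \<le> 2 * M * 1"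
    using k by (intro mult_left_mono) (auto simp: M_def)
  finally have "k * u \<le> 64 * real L ^ 2 + 2 * M" by simp
  then have "2 / \<delta> * (k * u) \<le> 2 / \<delta> * (64 * real L ^ 2 + 2 * M)"
    using \<delta> by (intro mult_left_mono) auto
  moreover have "2 / \<delta> * (k * u) = \<sigma> * real n * u"
    using \<delta> by (simp add: k_def)
  moreover have "u \<le> 2" unfolding u_def by (rule integral_p_le_2)
  ultimately have "(1 + \<sigma> * real n) * u \<le> upper_const L"
    by (simp add: upper_const_def \<delta>_def M_def algebra_simps)
  moreover have "0 < 1 + \<sigma> * real n" using sigma_pos by (simp add: add_pos_nonneg)
  ultimately show ?thesis unfolding u_def by (simp add: pos_le_divide_eq mult.commute)
qed

lemma upper_const_pos: "0 < upper_const L"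
  using decay_rate_pos by (simp add: upper_const_def add_pos_nonneg)

end

section \<open>Integration over the directions\<close>

lemma bij_betw_swap_cells: "bij_betw prod.swap (cells L) (cells L)"
  by (rule bij_betw_byWitness[where f' = prod.swap]) (auto simp: cells_def)

lemma bij_betw_flip_cells: "bij_betw (\<lambda>d. (fst d, L - 1 - snd d)) (cells L) (cells L)"
  by (rule bij_betw_byWitness[where f' = "\<lambda>d. (fst d, L - 1 - snd d)"]) (auto simp: cells_def)

context uniform_grid
begin

lemma integral_hit_prob_swap:
  "(LBINT s. hit_prob L X \<alpha> \<beta> n s) = (LBINT s. hit_prob L (map_pmf (image prod.swap) X) \<beta> \<alpha> n s)"
  using integral_hit_prob_transform[of prod.swap 1 \<alpha> \<beta> \<beta> \<alpha> 0 n]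
    bij_betw_imp_inj_on[OF bij_betw_swap_cells]
  by (simp add: lin_def shadow_def add.commute)

lemma integral_hit_prob_scale:
  assumes "\<alpha> \<noteq> 0" "0 \<le> \<alpha> * \<beta>"
  shows "(LBINT s. hit_prob L X \<alpha> \<beta> n s) = \<bar>\<alpha>\<bar> * (LBINT s. hit_prob L X 1 (\<bar>\<beta>\<bar> / \<bar>\<alpha>\<bar>) n s)"
proof -
  define \<sigma> where "\<sigma> = \<bar>\<beta>\<bar> / \<bar>\<alpha>\<bar>"
  have \<beta>: "\<beta> = \<alpha> * \<sigma>" and \<sigma>: "0 \<le> \<sigma>"
    using assms by (auto simp: \<sigma>_def zero_le_mult_iff abs_if)
  have "s \<in> shadow \<alpha> \<beta> \<longleftrightarrow> s / \<alpha> \<in> shadow 1 \<sigma>" for s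
  proof (cases "\<alpha> > 0")
    case True
    then have "0 \<le> \<beta>" using \<beta> \<sigma> by simp
    then show ?thesis using True \<sigma> \<beta> by (simp add: shadow_def field_simps)
  next
    case False
    with assms(1) have "\<alpha> < 0" by simp
    moreover from this have "\<beta> \<le> 0" using \<beta> \<sigma> by (simp add: mult_nonpos_nonneg)
    ultimately show ?thesis using \<sigma> \<beta> by (auto simp: shadow_def field_simps)
  qed
  moreover have "lin \<alpha> \<beta> d = \<alpha> * lin 1 \<sigma> d" for d
    by (simp add: lin_def \<beta> algebra_simps)
  ultimately show ?thesis
    using integral_hit_prob_transform[of "\<lambda>d. d" \<alpha> \<alpha> \<beta> 1 \<sigma> 0 n] assms(1)
    by (simp add: \<sigma>_def image_ident[abs_def] map_pmf_ident)
qed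

text \<open>The reflection \<open>y \<mapsto> 1 - y\<close>, which makes the signs of the
  coefficients agree as \<open>integral_hit_prob_scale\<close> requires.\<close>

lemma integral_hit_prob_flip:
  "(LBINT s. hit_prob L X \<alpha> \<beta> n s) =
    (LBINT s. hit_prob L (map_pmf (image (\<lambda>d. (fst d, L - 1 - snd d))) X) \<alpha> (- \<beta>) n s)"
proof -
  have "lin \<alpha> \<beta> d = 1 * lin \<alpha> (- \<beta>) (fst d, L - 1 - snd d) - (real L - 1) * (- \<beta>)"
    if "d \<in> cells L" for d
    using that by (auto simp: lin_def cells_def of_nat_diff algebra_simps)
  moreover have "s \<in> shadow \<alpha> \<beta> \<longleftrightarrow> (s + - \<beta>) / 1 \<in> shadow \<alpha> (- \<beta>)" for s
    by (auto simp: shadow_def max_def min_def)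
  ultimately show ?thesis
    using integral_hit_prob_transform[of "\<lambda>d. (fst d, L - 1 - snd d)" 1 \<alpha> \<beta> \<alpha> "- \<beta>" "- \<beta>" n]
      bij_betw_imp_inj_on[OF bij_betw_flip_cells] by simp
qed

text \<open>As \<open>\<bar>\<alpha>\<bar> \<le> 1\<close>, the ratio
  \<open>\<sigma> = \<bar>\<beta>\<bar> / \<bar>\<alpha>\<bar>\<close> is at least
  \<open>\<bar>\<beta>\<bar>\<close>, so the bound in \<open>\<sigma>\<close> weakens to one in the
  smaller coefficient.\<close>

lemma integral_hit_prob_le_steep:
  assumes "\<beta> \<noteq> 0" "\<bar>\<beta>\<bar> \<le> \<bar>\<alpha>\<bar>" "\<bar>\<alpha>\<bar> \<le> 1"
  shows "(LBINT s. hit_prob L X \<alpha> \<beta> n s) \<le> upper_const L / (1 + \<bar>\<beta>\<bar> * real n)"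
proof -
  have main: "(LBINT s. hit_prob L Y \<alpha> \<beta>' n s) \<le> upper_const L / (1 + \<bar>\<beta>\<bar> * real n)"
    if Y: "uniform_grid L Y" and \<beta>': "\<bar>\<beta>'\<bar> = \<bar>\<beta>\<bar>" "0 \<le> \<alpha> * \<beta>'" for Y \<beta>'
  proof -
    have \<alpha>: "\<bar>\<alpha>\<bar> > 0" using assms by linarith
    define \<sigma> where "\<sigma> = \<bar>\<beta>\<bar> / \<bar>\<alpha>\<bar>"
    have \<sigma>: "0 < \<sigma>" "\<sigma> \<le> 1" "\<bar>\<beta>\<bar> \<le> \<sigma>"
      using assms \<alpha> by (auto simp: \<sigma>_def field_simps mult_left_le)
    interpret Y: steep_lines L Y \<sigma>
      using Y \<sigma> by (simp add: steep_lines_def steep_lines_axioms_def)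
    have "(LBINT s. hit_prob L Y \<alpha> \<beta>' n s) = \<bar>\<alpha>\<bar> * (LBINT s. hit_prob L Y 1 \<sigma> n s)"
      using Y.integral_hit_prob_scale[of \<alpha> \<beta>' n] \<alpha> \<beta>' by (simp add: \<sigma>_def)
    also have "\<dots> \<le> 1 * (upper_const L / (1 + \<sigma> * real n))"
      using assms Y.integral_hit_prob_le[of n] Y.hit_prob_nonneg
      by (intro mult_mono) (auto intro!: Bochner_Integration.integral_nonneg)
    also have "\<dots> \<le> upper_const L / (1 + \<bar>\<beta>\<bar> * real n)"
      using Y.upper_const_pos \<sigma> assms
      by (simp, intro divide_left_mono add_left_mono mult_right_mono mult_pos_pos add_pos_nonneg) auto
    finally show ?thesis .
  qed
  show ?thesis
  proof (cases "0 \<le> \<alpha> * \<beta>")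
    case True
    then show ?thesis using main[of X \<beta>] uniform_grid_axioms by simp
  next
    case False
    then show ?thesis
      using main[OF uniform_grid_map[OF bij_betw_flip_cells], of "- \<beta>"]
      by (simp add: integral_hit_prob_flip[of \<alpha> \<beta> n])
  qed
qed

lemma upper_const_pos': "0 < upper_const L"
proof -
  interpret steep_lines L X 1 by unfold_locales auto
  show ?thesis by (rule upper_const_pos)
qed

text \<open>The smaller coefficient governs the bound; the sum of both kernels dominates the
  relevant one and can be integrated without comparing the coefficients.\<close>

lemma integral_hit_prob_le_min:
  assumes "\<alpha> \<noteq> 0" "\<beta> \<noteq> 0" "\<bar>\<alpha>\<bar> \<le> 1" "\<bar>\<beta>\<bar> \<le> 1"
  shows "(LBINT s. hit_prob L X \<alpha> \<beta> n s)
    \<le> upper_const L * (1 / (1 + \<bar>\<alpha>\<bar> * real n) + 1 / (1 + \<bar>\<beta>\<bar> * real n))"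
proof -
  interpret Y: uniform_grid L "map_pmf (image prod.swap) X"
    by (rule uniform_grid_map[OF bij_betw_swap_cells])
  have "0 \<le> 1 / (1 + \<bar>\<alpha>\<bar> * real n)" "0 \<le> 1 / (1 + \<bar>\<beta>\<bar> * real n)" by auto
  then have le: "upper_const L / (1 + \<bar>\<gamma>\<bar> * real n)
      \<le> upper_const L * (1 / (1 + \<bar>\<alpha>\<bar> * real n) + 1 / (1 + \<bar>\<beta>\<bar> * real n))"
    if "\<gamma> = \<alpha> \<or> \<gamma> = \<beta>" for \<gamma>
    using that upper_const_pos' by (auto simp: distrib_left)
  show ?thesis
  proof (cases "\<bar>\<beta>\<bar> \<le> \<bar>\<alpha>\<bar>")
    case True
    then show ?thesis
      using integral_hit_prob_le_steep[of \<beta> \<alpha> n] assms le[of \<beta>] by linarith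
  next
    case False
    then show ?thesis
      using Y.integral_hit_prob_le_steep[of \<alpha> \<beta> n] assms le[of \<alpha>]
      unfolding integral_hit_prob_swap[of \<alpha> \<beta> n] by linarith
  qed
qed

lemma integral_hit_prob_ge_columns:
  assumes columns: "\<And>A. A \<in> set_pmf X \<Longrightarrow> inj_on fst A"
    and \<beta>: "0 < \<alpha> * \<beta>" "\<bar>\<beta>\<bar> \<le> \<bar>\<alpha>\<bar>" "1/2 \<le> \<bar>\<alpha>\<bar>" "\<bar>\<beta>\<bar> \<le> x"
  shows "1 / (16 * (1 + 16 * real L ^ 4 * real n * x)) \<le> (LBINT s. hit_prob L X \<alpha> \<beta> n s)"
proof -
  have nz: "\<alpha> \<noteq> 0" "\<beta> \<noteq> 0" using \<beta>(1) by auto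
  define \<sigma> where "\<sigma> = \<bar>\<beta>\<bar> / \<bar>\<alpha>\<bar>"
  have "x * 1 \<le> x * (2 * \<bar>\<alpha>\<bar>)" using \<beta> by (intro mult_left_mono) auto
  then have \<sigma>: "0 < \<sigma>" "\<sigma> \<le> 1" "\<sigma> \<le> 2 * x"
    using nz \<beta> by (auto simp: \<sigma>_def pos_divide_le_eq mult_ac)
  interpret steep_lines L X \<sigma>
    using uniform_grid_axioms \<sigma> by (simp add: steep_lines_def steep_lines_axioms_def)
  have "1 / (16 * (1 + 16 * real L ^ 4 * real n * x)) = 1/2 * (1 / (8 * (1 + 8 * real L ^ 4 * (2 * x * real n))))"
    by (simp add: mult_ac)
  also have "\<dots> \<le> \<bar>\<alpha>\<bar> * (1 / (8 * (1 + 8 * real L ^ 4 * (\<sigma> * real n))))"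
    using \<sigma> \<beta>
    by (intro mult_mono divide_left_mono mult_left_mono add_left_mono mult_right_mono mult_pos_pos add_pos_nonneg) auto
  also have "\<dots> \<le> \<bar>\<alpha>\<bar> * (LBINT s. hit_prob L X 1 \<sigma> n s)"
    using integral_hit_prob_ge[OF columns, of n] by (intro mult_left_mono) auto
  also have "\<dots> = (LBINT s. hit_prob L X \<alpha> \<beta> n s)"
    using integral_hit_prob_scale[of \<alpha> \<beta> n] nz \<beta>(1) by (simp add: \<sigma>_def)
  finally show ?thesis .
qed

end

section \<open>Integrating the kernel 1 / (1 + \<sigma> n) over the angle\<close>

lemma sin_ge_quarter:
  assumes "0 \<le> x" "x \<le> pi / 2"
  shows "x / 4 \<le> sin x"
proof (cases "x \<le> pi / 3")
  case True
  have "sin 0 - 0 / 4 \<le> sin x - x / 4"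
  proof (rule DERIV_nonneg_imp_nondecreasing[OF assms(1)])
    fix y assume y: "0 \<le> y" "y \<le> x"
    have "cos (pi / 3) \<le> cos y"
      using y True by (intro cos_monotone_0_pi_le) auto
    then have "0 \<le> cos y - 1 / 4" by (simp add: cos_60)
    moreover have "((\<lambda>x. sin x - x / 4) has_real_derivative (cos y - 1 / 4)) (at y)"
      by (auto intro!: derivative_eq_intros)
    ultimately show "\<exists>z. ((\<lambda>x. sin x - x / 4) has_real_derivative z) (at y) \<and> 0 \<le> z"
      by blast
  qed
  then show ?thesis by simp
next
  case False
  have "sin (pi / 6) \<le> sin x"
    using False assms by (intro sin_monotone_2pi_le) auto
  then have "1 / 2 \<le> sin x" by (simp add: sin_30)
  moreover have "x / 4 \<le> 1 / 2" using assms pi_less_4 by linarith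
  ultimately show ?thesis by linarith
qed

lemma integral_log_kernel:
  fixes D b :: real
  assumes "0 < D" "0 \<le> b"
  shows "integrable lborel (\<lambda>x. indicator {0..b} x * (1 / (1 + D * x)))"
    and "(LBINT x. indicator {0..b} x * (1 / (1 + D * x))) = ln (1 + D * b) / D"
proof -
  have "has_bochner_integral lborel (\<lambda>x. 1 / (1 + D * x) * indicator {0..b} x)
      (ln (1 + D * b) / D - ln (1 + D * 0) / D)"
  proof (rule has_bochner_integral_FTC_Icc_real[OF assms(2)])
    fix x :: real assume "0 \<le> x"
    then have pos: "1 + D * x > 0" using assms by (simp add: add_pos_nonneg)
    show "((\<lambda>x. ln (1 + D * x) / D) has_real_derivative 1 / (1 + D * x)) (at x)"
    proof -
      have "((\<lambda>x. ln (1 + D * x)) has_real_derivative D / (1 + D * x)) (at x)"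
        using pos by (auto intro!: derivative_eq_intros)
      from DERIV_cdivide[OF this, of D] show ?thesis using assms by simp
    qed
    show "isCont (\<lambda>x. 1 / (1 + D * x)) x"
      using pos by (intro continuous_intros) auto
  qed
  then have "has_bochner_integral lborel (\<lambda>x. indicator {0..b} x * (1 / (1 + D * x))) (ln (1 + D * b) / D)"
    by (simp add: mult.commute)
  then show "integrable lborel (\<lambda>x. indicator {0..b} x * (1 / (1 + D * x)))"
    "(LBINT x. indicator {0..b} x * (1 / (1 + D * x))) = ln (1 + D * b) / D"
    by (simp_all add: has_bochner_integral_iff)
qed

context uniform_grid
begin

lemma expected_Fav_le:
  assumes "n \<ge> 2"
  shows "measure_pmf.expectation (gen_sets L X n) (\<lambda>S. Fav (union_squares L n S))
    \<le> 32 * upper_const L * ln (real n) / real n"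
proof -
  define I where "I \<theta> = (LBINT s. hit_prob L X (- sin \<theta>) (cos \<theta>) n s)" for \<theta>
  define k where "k x = indicator {0..pi} x * (1 / (1 + real n / 4 * x))" for x
  define C where "C = upper_const L"
  have C: "0 < C" using upper_const_pos' by (simp add: C_def)
  have n: "real n \<ge> 2" using assms by simp
  have k0: "0 \<le> k x" for x by (auto simp: k_def indicator_def)
  have k_le: "1 / (1 + \<bar>y\<bar> * real n) \<le> k x" if "0 \<le> x" "x \<le> pi / 2" "x / 4 \<le> \<bar>y\<bar>" for x y
  proof -
    have "real n / 4 * x \<le> \<bar>y\<bar> * real n" using mult_right_mono[OF that(3), of "real n"] by (simp add: mult.commute)
    then show ?thesis
      using that pi_gt_zero by (auto simp: k_def intro!: divide_left_mono mult_pos_pos add_pos_nonneg)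
  qed
  have int_k: "integrable lborel k" "(LBINT x. k x) = ln (1 + real n / 4 * pi) / (real n / 4)"
    unfolding k_def using integral_log_kernel[of "real n / 4" pi] n by auto
  have int_affine: "integrable lborel (\<lambda>x. k (a + b * x)) \<and> (LBINT x. k (a + b * x)) = (LBINT x. k x)"
    if "\<bar>b\<bar> = 1" for a b
    using lborel_integrable_real_affine[OF int_k(1), of b a] lborel_integral_real_affine[of b k a] that by auto
  \<comment> \<open>One copy of the kernel for each approach to a direction with a vanishing
    coefficient: \<open>0\<close> from above, \<open>pi\<close> from below, and
    \<open>pi / 2\<close> from both sides.\<close>
  define H where "H \<theta> = C * (k \<theta> + k (pi - \<theta>) + k (pi / 2 - \<theta>) + k (\<theta> - pi / 2))" for \<theta>
  have "integrable lborel (\<lambda>\<theta>. k (pi - \<theta>))" "(LBINT \<theta>. k (pi - \<theta>)) = (LBINT x. k x)"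
    "integrable lborel (\<lambda>\<theta>. k (pi / 2 - \<theta>))" "(LBINT \<theta>. k (pi / 2 - \<theta>)) = (LBINT x. k x)"
    "integrable lborel (\<lambda>\<theta>. k (\<theta> - pi / 2))" "(LBINT \<theta>. k (\<theta> - pi / 2)) = (LBINT x. k x)"
    using int_affine[of "-1" pi] int_affine[of "-1" "pi / 2"] int_affine[of 1 "- (pi / 2)"] by simp_all
  then have H: "integrable lborel H" "(LBINT \<theta>. H \<theta>) = 4 * C * (LBINT x. k x)"
    using int_k(1) by (simp_all add: H_def[abs_def])
  have I_le: "indicator {0..pi} \<theta> * I \<theta> \<le> H \<theta>" if \<theta>: "\<theta> \<noteq> 0" "\<theta> \<noteq> pi / 2" "\<theta> \<noteq> pi" for \<theta>
  proof (cases "\<theta> \<in> {0..pi}")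
    case False
    then show ?thesis using k0 C by (auto simp: H_def intro!: mult_nonneg_nonneg add_nonneg_nonneg)
  next
    case True
    then have r: "0 < \<theta>" "\<theta> < pi" using \<theta> by auto
    have sin: "sin \<theta> > 0" using r by (rule sin_gt_zero)
    have cos: "cos \<theta> \<noteq> 0"
    proof
      assume "cos \<theta> = 0"
      then have "cos \<theta> = cos (pi / 2)" by simp
      then have "\<theta> = pi / 2" using r cos_inj_pi[of \<theta> "pi / 2"] by simp
      with \<theta> show False by simp
    qed
    have "I \<theta> \<le> C * (1 / (1 + \<bar>sin \<theta>\<bar> * real n) + 1 / (1 + \<bar>cos \<theta>\<bar> * real n))"
      using integral_hit_prob_le_min[of "- sin \<theta>" "cos \<theta>" n] sin cos
      by (simp add: I_def C_def abs_sin_le_one abs_cos_le_one del: abs_le_iff)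
    moreover have "1 / (1 + \<bar>sin \<theta>\<bar> * real n) \<le> k \<theta> + k (pi - \<theta>)"
    proof (cases "\<theta> \<le> pi / 2")
      case True
      then show ?thesis using k_le[of \<theta> "sin \<theta>"] sin_ge_quarter[of \<theta>] r k0[of "pi - \<theta>"] by auto
    next
      case False
      then show ?thesis
        using k_le[of "pi - \<theta>" "sin \<theta>"] sin_ge_quarter[of "pi - \<theta>"] r k0[of \<theta>] by auto
    qed
    moreover have "1 / (1 + \<bar>cos \<theta>\<bar> * real n) \<le> k (pi / 2 - \<theta>) + k (\<theta> - pi / 2)"
    proof (cases "\<theta> \<le> pi / 2")
      case True
      have "cos \<theta> = sin (pi / 2 - \<theta>)" by (simp add: sin_diff)
      then show ?thesis
        using True k_le[of "pi / 2 - \<theta>" "cos \<theta>"] sin_ge_quarter[of "pi / 2 - \<theta>"] r k0[of "\<theta> - pi / 2"] by auto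
    next
      case False
      have "cos \<theta> = - sin (\<theta> - pi / 2)" by (simp add: sin_diff)
      then show ?thesis
        using False k_le[of "\<theta> - pi / 2" "cos \<theta>"] sin_ge_quarter[of "\<theta> - pi / 2"] r k0[of "pi / 2 - \<theta>"] by auto
    qed
    ultimately have "I \<theta> \<le> C * ((k \<theta> + k (pi - \<theta>)) + (k (pi / 2 - \<theta>) + k (\<theta> - pi / 2)))"
      using C by (meson add_mono mult_left_mono less_imp_le order_trans)
    then show ?thesis using True by (simp add: H_def add_ac)
  qed
  have "measure_pmf.expectation (gen_sets L X n) (\<lambda>S. Fav (union_squares L n S)) =
      (LBINT \<theta>. indicator {0..pi} \<theta> * I \<theta>)"
    unfolding expected_Fav(2) by (simp add: set_lebesgue_integral_def I_def)
  also have "\<dots> \<le> (LBINT \<theta>. H \<theta>)"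
  proof (rule integral_mono_AE)
    show "integrable lborel (\<lambda>\<theta>. indicator {0..pi} \<theta> * I \<theta>)"
      using expected_Fav(1)[of n] by (simp add: set_integrable_def I_def)
    show "AE \<theta> in lborel. indicator {0..pi} \<theta> * I \<theta> \<le> H \<theta>"
      \<comment> \<open>The three directions in which a coefficient vanishes are a null set.\<close>
      using AE_lborel_singleton[of 0] AE_lborel_singleton[of "pi / 2"] AE_lborel_singleton[of pi]
      by eventually_elim (rule I_le)
  qed (rule H)
  also have "\<dots> = 16 * C * ln (1 + real n / 4 * pi) / real n"
    unfolding H(2) int_k(2) by simp
  also have "\<dots> \<le> 16 * C * (2 * ln (real n)) / real n"
  proof -
    have "real n / 4 * pi \<le> real n / 4 * 4" using pi_less_4 by (intro mult_left_mono) auto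
    then have "1 + real n / 4 * pi \<le> 1 + real n" by simp
    also have "\<dots> \<le> real n * 2" using n by simp
    also have "\<dots> \<le> real n ^ 2"
      unfolding power2_eq_square using n by (intro mult_left_mono) auto
    finally have "ln (1 + real n / 4 * pi) \<le> ln (real n ^ 2)"
      using n by (intro ln_mono) (auto intro!: add_pos_nonneg)
    then show ?thesis
      using C n by (intro divide_right_mono mult_left_mono) (auto simp: ln_realpow)
  qed
  finally show ?thesis by (simp add: C_def)
qed

text \<open>\<open>a\<close> is the direction near which the logarithm arises and \<open>b\<close>
  the side of approach; an angle of \<open>pi / 4\<close> on one side already produces it.\<close>

lemma expected_Fav_ge:
  assumes "n \<ge> 2" and b: "\<bar>b\<bar> = 1"
    and range: "\<And>x. 0 \<le> x \<Longrightarrow> x \<le> pi / 4 \<Longrightarrow> a + b * x \<in> {0..pi}"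
    and lower: "\<And>x. 0 < x \<Longrightarrow> x \<le> pi / 4 \<Longrightarrow> 1 / (16 * (1 + 16 * real L ^ 4 * real n * x))
      \<le> (LBINT s. hit_prob L X (- sin (a + b * x)) (cos (a + b * x)) n s)"
  shows "1 / (256 * real L ^ 4) * ln (real n) / real n
    \<le> measure_pmf.expectation (gen_sets L X n) (\<lambda>S. Fav (union_squares L n S))"
proof -
  define I where "I \<theta> = (LBINT s. hit_prob L X (- sin \<theta>) (cos \<theta>) n s)" for \<theta>
  define f where "f \<theta> = indicator {0..pi} \<theta> * I \<theta>" for \<theta>
  define D where "D = 16 * real L ^ 4 * real n"
  have D: "16 * real n \<le> D" "0 < D"
  proof -
    have "1 \<le> real L ^ 4" using L_real by (intro one_le_power) auto
    then have "16 * 1 * real n \<le> 16 * real L ^ 4 * real n" by (intro mult_right_mono) auto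
    then show "16 * real n \<le> D" by (simp add: D_def)
    then show "0 < D" using assms(1) by linarith
  qed
  have I0: "0 \<le> I \<theta>" for \<theta> unfolding I_def by (intro Bochner_Integration.integral_nonneg hit_prob_nonneg)
  have b0: "b \<noteq> 0" using b by auto
  have int_f: "integrable lborel f"
    using expected_Fav(1)[of n] by (simp add: set_integrable_def I_def f_def[abs_def])
  have "1 / (256 * real L ^ 4) * ln (real n) / real n = 1/16 * (ln (real n) / D)"
    by (simp add: D_def)
  also have "\<dots> \<le> 1/16 * (ln (1 + D * (pi / 4)) / D)"
  proof -
    have "real n \<le> D * (1 / 4)" using D by simp
    also have "\<dots> \<le> D * (pi / 4)" using D pi_ge_two by (intro mult_left_mono) auto
    finally have "ln (real n) \<le> ln (1 + D * (pi / 4))"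
      using assms(1) by (intro ln_mono) auto
    then show ?thesis using D by (intro mult_left_mono divide_right_mono) auto
  qed
  also have "\<dots> = (LBINT x. 1/16 * (indicator {0..pi / 4} x * (1 / (1 + D * x))))"
    by (subst integral_mult_right_zero, subst integral_log_kernel(2)[OF D(2)]) simp_all
  also have "\<dots> \<le> (LBINT x. f (a + b * x))"
  proof (rule integral_mono_AE)
    show "integrable lborel (\<lambda>x. 1/16 * (indicator {0..pi / 4} x * (1 / (1 + D * x))))"
      using integral_log_kernel(1)[OF D(2), of "pi / 4"] by (intro integrable_mult_right) auto
    show "integrable lborel (\<lambda>x. f (a + b * x))"
      using lborel_integrable_real_affine[OF int_f b0] .
    have pointwise: "1/16 * (indicator {0..pi / 4} x * (1 / (1 + D * x))) \<le> f (a + b * x)" if "x \<noteq> 0" for x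
    proof (cases "x \<in> {0..pi / 4}")
      case True
      then show ?thesis
        using lower[of x] range[of x] that by (simp add: f_def I_def D_def)
    next
      case False
      then show ?thesis using I0 by (simp add: f_def)
    qed
    show "AE x in lborel. 1/16 * (indicator {0..pi / 4} x * (1 / (1 + D * x))) \<le> f (a + b * x)"
      using AE_lborel_singleton[of 0] by eventually_elim (rule pointwise)
  qed
  also have "\<dots> = (LBINT \<theta>. f \<theta>)"
    using lborel_integral_real_affine[OF b0, of f a] b by simp
  also have "\<dots> = measure_pmf.expectation (gen_sets L X n) (\<lambda>S. Fav (union_squares L n S))"
    unfolding expected_Fav(2) by (simp add: set_lebesgue_integral_def I_def f_def)
  finally show ?thesis .
qed

end

lemma cos_ge_half:
  assumes "0 \<le> x" "x \<le> pi / 4"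
  shows "1 / 2 \<le> cos x" "sin x \<le> cos x"
proof -
  have "cos (pi / 3) \<le> cos x" using assms by (intro cos_monotone_0_pi_le) auto
  then show "1 / 2 \<le> cos x" by (simp add: cos_60)
  have "sin x \<le> sin (pi / 4)" using assms by (intro sin_monotone_2pi_le) auto
  also have "\<dots> = cos (pi / 4)" by (simp add: sin_45 cos_45)
  also have "\<dots> \<le> cos x" using assms by (intro cos_monotone_0_pi_le) auto
  finally show "sin x \<le> cos x" .
qed

lemma inj_on_fst_if_card_columns:
  assumes "A \<subseteq> cells L" "\<forall>i<L. card {j. (i, j) \<in> A} = 1"
  shows "inj_on fst A"
proof (rule inj_onI)
  fix d d' assume "d \<in> A" "d' \<in> A" "fst d = fst d'"
  moreover have "fst d < L" using assms(1) \<open>d \<in> A\<close> by (auto simp: cells_def)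
  then obtain j where "{j. (fst d, j) \<in> A} = {j}" using assms(2) card_1_singletonE by blast
  ultimately show "d = d'" by (metis (mono_tags) mem_Collect_eq prod.collapse singletonD)
qed

theorem theorem4p2:
  fixes L :: nat and X :: "(nat \<times> nat) set pmf"
  assumes "L \<ge> 2"
    and "grid_model L X"
    and "uniform_model L X"
    and "vert_degenerate L X \<or> horiz_degenerate L X"
  shows "\<exists>c C. 0 < c \<and> c \<le> C \<and>
           (\<forall>n::nat. n \<ge> 2 \<longrightarrow>
              c * ln (real n) / real n
                \<le> measure_pmf.expectation (gen_sets L X n) (\<lambda>S. Fav (union_squares L n S))
            \<and> measure_pmf.expectation (gen_sets L X n) (\<lambda>S. Fav (union_squares L n S))
                \<le> C * ln (real n) / real n)"
proof -
  interpret uniform_grid L X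
    using assms(1-3) by unfold_locales (auto simp: grid_model_def uniform_model_def cells_def)
  interpret Y: uniform_grid L "map_pmf (image prod.swap) X"
    by (rule uniform_grid_map[OF bij_betw_swap_cells])
  let ?E = "\<lambda>n. measure_pmf.expectation (gen_sets L X n) (\<lambda>S. Fav (union_squares L n S))"
  define c where "c = 1 / (256 * real L ^ 4)"
  define C where "C = 32 * upper_const L"
  have lower: "c * ln (real n) / real n \<le> ?E n" if n: "n \<ge> 2" for n
    using assms(4)
  proof
    assume "vert_degenerate L X"
    then have columns: "inj_on fst A" if "A \<in> set_pmf X" for A
      using that subset_cells[OF that] inj_on_fst_if_card_columns by (auto simp: vert_degenerate_def)
    show ?thesis
      unfolding c_def
    \<comment> \<open>On this side the coefficients are \<open>- cos x\<close> and
      \<open>- sin x\<close>, so their product is positive as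
      \<open>integral_hit_prob_ge_columns\<close> asks.\<close>
    proof (rule expected_Fav_ge[OF n, where a = "pi / 2" and b = 1])
      fix x :: real assume x: "0 < x" "x \<le> pi / 4"
      have sc: "sin (pi / 2 + 1 * x) = cos x" "cos (pi / 2 + 1 * x) = - sin x"
        by (simp_all add: sin_add cos_add)
      have "0 < sin x" using x by (intro sin_gt_zero) auto
      then show "1 / (16 * (1 + 16 * real L ^ 4 * real n * x))
        \<le> (LBINT s. hit_prob L X (- sin (pi / 2 + 1 * x)) (cos (pi / 2 + 1 * x)) n s)"
        unfolding sc using cos_ge_half[of x] x sin_x_le_x[of x]
        by (intro integral_hit_prob_ge_columns columns) (auto intro!: mult_pos_pos)
    qed auto
  next
    assume h: "horiz_degenerate L X"
    have columns: "inj_on fst A" if A: "A \<in> set_pmf (map_pmf (image prod.swap) X)" for A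
    proof -
      obtain B where B: "B \<in> set_pmf X" "A = prod.swap ` B" using A by auto
      have "{j. (i, j) \<in> A} = {j. (j, i) \<in> B}" for i using B(2) by auto
      then have "\<forall>i<L. card {j. (i, j) \<in> A} = 1" using h B(1) by (simp add: horiz_degenerate_def)
      then show ?thesis using Y.subset_cells[OF A] inj_on_fst_if_card_columns by blast
    qed
    show ?thesis
      unfolding c_def
    \<comment> \<open>Here the coefficients are \<open>- sin x\<close> and \<open>- cos x\<close>;
      swapping the coordinates puts the dominant one first and turns rows into columns.\<close>
    proof (rule expected_Fav_ge[OF n, where a = pi and b = "- 1"])
      fix x :: real assume x: "0 < x" "x \<le> pi / 4"
      have sc: "sin (pi + - 1 * x) = sin x" "cos (pi + - 1 * x) = - cos x"
        by (simp_all add: sin_diff cos_diff)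
      have "0 < sin x" using x by (intro sin_gt_zero) auto
      then show "1 / (16 * (1 + 16 * real L ^ 4 * real n * x))
        \<le> (LBINT s. hit_prob L X (- sin (pi + - 1 * x)) (cos (pi + - 1 * x)) n s)"
        unfolding sc integral_hit_prob_swap using cos_ge_half[of x] x sin_x_le_x[of x]
        by (intro Y.integral_hit_prob_ge_columns columns) (auto intro!: mult_pos_pos)
    qed auto
  qed
  have upper: "?E n \<le> C * ln (real n) / real n" if "n \<ge> 2" for n
    unfolding C_def by (rule expected_Fav_le[OF that])
  \<comment> \<open>The order of the two constants is read off from both bounds at
    \<open>n = 2\<close>.\<close>
  have "c * ln (real 2) / real 2 \<le> C * ln (real 2) / real 2"
    using lower[of 2] upper[of 2] by linarith
  then have "c \<le> C" by simp
  moreover have "0 < c" using L_pos by (simp add: c_def)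
  ultimately show ?thesis using lower upper by blast
qed

end
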